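(* CMC surfaces in $3$-dimensional space-forms are the constrained Willmore surfaces in $3$-space admitting a $q$-conserved quantity for some multiplier $q$. That is, for $n=3$, a surface $\Lambda\subset M\times\mathbb{R}^{4,1}$ has constant mean curvature in the space-form $S_{v_\infty}$ for some non-zero $v_\infty\in\mathbb{R}^{4,1}$ if and only if $\Lambda$ is constrained Willmore and admits a $q$-conserved quantity for some multiplier $q$ to $\Lambda$.
   Context: $\mathbb{R}^{4,1}$ has metric $(\,,\,)$ of signature $(4,1)$, extended complex bilinearly to $\mathbb{C}^{5}$; $\mathcal{L}$ is the set of non-zero null vectors of $\mathbb{R}^{4,1}$; $M$ is an oriented surface; $d$ is the trivial flat connection on $M\times\mathbb{R}^{4,1}$ and its complexification. The theory is local: restriction to a suitable non-empty open subset of $M$ is always understood. $\wedge^{2}\mathbb{R}^{4,1}\cong o(\mathbb{R}^{4,1})$ by $(v_1\wedge v_2)(w)=(w,v_1)v_2-(w,v_2)v_1$; $[\mu\wedge\eta](X,Y)=[\mu_X,\eta_Y]-[\mu_Y,\eta_X]$; $d^\nabla$ is the exterior derivative on endomorphism-valued forms. A surface is a null line subbundle $\Lambda\subset M\times\mathbb{R}^{4,1}$ defining an immersion $M\to\mathbb{P}(\mathcal{L})\cong S^3$ (standing assumption: not contained in any $2$-sphere of $S^3$). $M$ carries the conformal structure of the metrics $g_\sigma(X,Y)=(d_X\sigma,d_Y\sigma)$, $\sigma\in\Gamma(\Lambda)$ never-zero; $(1,0)$/$(0,1)$-parts and $*$ (with $*\omega=-\omega\circ J$) refer to it. For a holomorphic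 chart $z$, $\Lambda^{(1)}=\langle\sigma,\sigma_z,\sigma_{\bar z}\rangle$ and the central sphere congruence is (complexified) $S=\langle\sigma,\sigma_z,\sigma_{\bar z},\sigma_{z\bar z}\rangle$. $\mathcal{D}:=\pi_S\circ d\circ\pi_S+\pi_{S^\perp}\circ d\circ\pi_{S^\perp}$, $\mathcal{N}:=d-\mathcal{D}$. For a real $q\in\Omega^1(\Lambda\wedge\Lambda^{(1)})$, $\Lambda$ is $q$-constrained Willmore, and $q$ is a multiplier, if $d^{\mathcal{D}}q=0$ and $d^{\mathcal{D}}*\mathcal{N}=2[q\wedge*\mathcal{N}]$; $\Lambda$ is constrained Willmore if a multiplier exists. Set $d^{\lambda,q}_S:=\mathcal{D}+\lambda^{-1}\mathcal{N}^{1,0}+\lambda\mathcal{N}^{0,1}+(\lambda^{-2}-1)q^{1,0}+(\lambda^2-1)q^{0,1}$. A $q$-conserved quantity of a $q$-constrained Willmore $\Lambda$ is a Laurent polynomial $p(\lambda)=\lambda^{-1}v+v_0+\lambda\overline v$ with $v_0\in\Gamma(S)$ real, $v\in\Gamma(S^\perp)$, $p(1)\ne0$ and $d^{\lambda,q}_Sp(\lambda)=0$ for all $\lambda\in\mathbb{C}\backslash\{0\}$. For non-zero $v_\infty\in\mathbb{R}^{4,1}$, $S_{v_\infty}=\{v\in\mathcal{L}:(v,v_\infty)=-1\}$ (a space-form of curvature $-(v_\infty,v_\infty)$), and $v_\infty^\perp$ is the orthogonal projection of $v_\infty$ onto $S^\perp$. The mean curvature of $\Lambda$ in $S_{v_\infty}$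 is $H_\infty:=(v_\infty^\perp,v_\infty^\perp)^{1/2}$, and $\Lambda$ has constant mean curvature (is CMC) in $S_{v_\infty}$ if $(v_\infty^\perp,v_\infty^\perp)$ is constant. *)

theory Defs
  imports "HOL-Analysis.Analysis"
begin

section \<open>The metric of signature (4,1)\<close>

text \<open>Used both over the reals and, as its complex bilinear extension, over the complex numbers.\<close>

definition lor :: "'a::comm_ring_1 ^ 5 \<Rightarrow> 'a ^ 5 \<Rightarrow> 'a" where
  "lor v w = v $ 1 * w $ 1 + v $ 2 * w $ 2 + v $ 3 * w $ 3 + v $ 4 * w $ 4 - v $ 5 * w $ 5"

definition cvec :: "real ^ 5 \<Rightarrow> complex ^ 5" where
  "cvec v = (\<chi> i. complex_of_real (v $ i))"

definition cnjv :: "complex ^ 5 \<Rightarrow> complex ^ 5" where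
  "cnjv v = (\<chi> i. cnj (v $ i))"

definition wedge :: "complex ^ 5 \<Rightarrow> complex ^ 5 \<Rightarrow> complex ^ 5 ^ 5" where
  "wedge v1 v2 = matrix (\<lambda>w. lor w v1 *s v2 - lor w v2 *s v1)"

text \<open>Orthogonal projection onto a non-degenerate complex subspace.\<close>

definition proj_on :: "(complex ^ 5) set \<Rightarrow> complex ^ 5 \<Rightarrow> complex ^ 5" where
  "proj_on V w = (THE u. u \<in> V \<and> (\<forall>y\<in>V. lor (w - u) y = 0))"

definition proj_perp :: "(complex ^ 5) set \<Rightarrow> complex ^ 5 \<Rightarrow> complex ^ 5" where
  "proj_perp V w = w - proj_on V w"


section \<open>Calculus on open subsets of the plane\<close>

text \<open>The derivative of \<open>f\<close> at \<open>p\<close> in the direction \<open>X\<close>.\<close>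

definition dir :: "(complex \<Rightarrow> 'b::real_normed_vector) \<Rightarrow> complex \<Rightarrow> complex \<Rightarrow> 'b" where
  "dir f p X = frechet_derivative f (at p) X"

primrec Ck_on :: "nat \<Rightarrow> complex set \<Rightarrow> (complex \<Rightarrow> 'b::real_normed_vector) \<Rightarrow> bool" where
  "Ck_on 0 D f \<longleftrightarrow> continuous_on D f"
| "Ck_on (Suc k) D f \<longleftrightarrow>
     (\<forall>p\<in>D. f differentiable (at p)) \<and> (\<forall>X. Ck_on k D (\<lambda>p. dir f p X))"

definition smooth_on :: "complex set \<Rightarrow> (complex \<Rightarrow> 'b::real_normed_vector) \<Rightarrow> bool" where
  "smooth_on D f \<longleftrightarrow> (\<forall>k. Ck_on k D f)"

definition d_z :: "(complex \<Rightarrow> complex ^ 5) \<Rightarrow> complex \<Rightarrow> complex ^ 5" where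
  "d_z f p = (1/2) *s (dir f p 1 - \<i> *s dir f p \<i>)"

definition d_zbar :: "(complex \<Rightarrow> complex ^ 5) \<Rightarrow> complex \<Rightarrow> complex ^ 5" where
  "d_zbar f p = (1/2) *s (dir f p 1 + \<i> *s dir f p \<i>)"


section \<open>Oriented surfaces\<close>

text \<open>A chart \<open>z\<close> with domain \<open>W\<close>, and an atlas of an oriented smooth surface whose underlying
  space is the whole type \<open>'m\<close>. The last condition of \<open>compatible\<close> is that the Jacobian determinant
  of the transition map is positive.\<close>

type_synonym 'm chart = "'m set \<times> ('m \<Rightarrow> complex)"

definition is_chart :: "('m::topological_space) chart \<Rightarrow> bool" where
  "is_chart c \<longleftrightarrow> (case c of (W, z) \<Rightarrow>
     open W \<and> open (z ` W) \<and> homeomorphism W (z ` W) z (inv_into W z))"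

definition compatible :: "('m::topological_space) chart \<Rightarrow> 'm chart \<Rightarrow> bool" where
  "compatible c d \<longleftrightarrow> (case (c, d) of ((W, z), (V, w)) \<Rightarrow>
     smooth_on (z ` (W \<inter> V)) (w \<circ> inv_into W z) \<and>
     (\<forall>p\<in>z ` (W \<inter> V). 0 < Im (cnj (dir (w \<circ> inv_into W z) p 1) * dir (w \<circ> inv_into W z) p \<i>)))"

definition oriented_atlas ::
    "('m::{t2_space, second_countable_topology}) chart set \<Rightarrow> bool" where
  "oriented_atlas A \<longleftrightarrow> (\<forall>c\<in>A. is_chart c) \<and> (\<forall>c\<in>A. \<forall>d\<in>A. compatible c d) \<and> (\<Union>c\<in>A. fst c) = UNIV"

definition oriented_chart ::
    "('m::{t2_space, second_countable_topology}) chart set \<Rightarrow> 'm chart \<Rightarrow> bool" where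
  "oriented_chart A c \<longleftrightarrow> is_chart c \<and> (\<forall>d\<in>A. compatible c d \<and> compatible d c)"


section \<open>Surfaces in the conformal 3-sphere\<close>

text \<open>\<open>lift A \<Lambda> W z \<sigma>\<close>: \<open>\<sigma>\<close> is a smooth never-zero section of the line bundle \<open>\<Lambda>\<close> over the
  domain \<open>W\<close> of the chart \<open>z\<close>, read in the coordinate \<open>z\<close>.\<close>

definition lift :: "('m::{t2_space, second_countable_topology}) chart set \<Rightarrow> ('m \<Rightarrow> (real ^ 5) set)
    \<Rightarrow> 'm set \<Rightarrow> ('m \<Rightarrow> complex) \<Rightarrow> (complex \<Rightarrow> real ^ 5) \<Rightarrow> bool" where
  "lift A \<Lambda> W z \<sigma> \<longleftrightarrow> oriented_chart A (W, z) \<and> smooth_on (z ` W) \<sigma> \<and>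
     (\<forall>x\<in>W. \<sigma> (z x) \<noteq> 0 \<and> \<Lambda> x = span {\<sigma> (z x)})"

text \<open>The differential at \<open>p\<close> of the map into projective space induced by \<open>\<sigma>\<close> is \<open>d\<sigma>\<close> modulo
  \<open>\<sigma>\<close>. The 2-spheres in the projectivized light cone are the sets of null lines orthogonal to a
  fixed space-like vector.\<close>

definition surface ::
    "('m::{t2_space, second_countable_topology}) chart set \<Rightarrow> ('m \<Rightarrow> (real ^ 5) set) \<Rightarrow> bool" where
  "surface A \<Lambda> \<longleftrightarrow>
     (\<forall>x. \<forall>l\<in>\<Lambda> x. lor l l = 0) \<and>
     (\<forall>x. \<exists>W z \<sigma>. x \<in> W \<and> lift A \<Lambda> W z \<sigma> \<and>
        (\<forall>p\<in>z ` W. \<forall>X. X \<noteq> 0 \<longrightarrow> dir \<sigma> p X \<notin> span {\<sigma> p})) \<and>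
     \<not> (\<exists>w. lor w w > 0 \<and> (\<forall>x. \<forall>l\<in>\<Lambda> x. lor l w = 0))"

text \<open>A lift over a holomorphic chart: \<open>z\<close> is conformal for the metric
  \<open>g\<^sub>\<sigma>(X,Y) = (d\<^sub>X\<sigma>, d\<^sub>Y\<sigma>)\<close>, so that in this coordinate the complex structure \<open>J\<close> of the surface is
  multiplication by \<open>\<i>\<close>. The condition does not depend on the choice of \<open>\<sigma>\<close>.\<close>

definition holomorphic_lift :: "('m::{t2_space, second_countable_topology}) chart set
    \<Rightarrow> ('m \<Rightarrow> (real ^ 5) set) \<Rightarrow> 'm set \<Rightarrow> ('m \<Rightarrow> complex) \<Rightarrow> (complex \<Rightarrow> real ^ 5) \<Rightarrow> bool" where
  "holomorphic_lift A \<Lambda> W z \<sigma> \<longleftrightarrow> lift A \<Lambda> W z \<sigma> \<and>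
     (\<forall>p\<in>z ` W. \<exists>u>0. \<forall>X Y. lor (dir \<sigma> p X) (dir \<sigma> p Y) = u * (X \<bullet> Y))"

text \<open>The property \<open>P\<close>, formulated for the image \<open>D\<close> of a holomorphic chart and a lift \<open>\<sigma>\<close> over it,
  holds after restriction of the surface to a suitable non-empty open subset of \<open>U\<close>. All properties
  to which this is applied depend only on the line bundle spanned by \<open>\<sigma>\<close> and are invariant under
  holomorphic changes of the coordinate. Holomorphic charts exist near every point (isothermal
  coordinates), so it is no loss to restrict to the domain of one.\<close>

definition holds_on_restriction :: "('m::{t2_space, second_countable_topology}) chart set
    \<Rightarrow> ('m \<Rightarrow> (real ^ 5) set) \<Rightarrow> 'm set
    \<Rightarrow> (complex set \<Rightarrow> (complex \<Rightarrow> real ^ 5) \<Rightarrow> bool) \<Rightarrow> bool" where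
  "holds_on_restriction A \<Lambda> U P \<longleftrightarrow>
     (\<exists>W z \<sigma>. holomorphic_lift A \<Lambda> W z \<sigma> \<and> W \<noteq> {} \<and> W \<subseteq> U \<and> P (z ` W) \<sigma>)"


section \<open>The central sphere congruence and the associated splitting of \<open>d\<close>\<close>

text \<open>From here on \<open>\<sigma>\<close> is a lift in a holomorphic coordinate. A 1-form is a function of a point and
  a tangent vector, where tangent vectors (and constant vector fields) are complex numbers, with
  \<open>J X = \<i> * X\<close>.\<close>

definition Lambda1 :: "(complex \<Rightarrow> real ^ 5) \<Rightarrow> complex \<Rightarrow> (complex ^ 5) set" where
  "Lambda1 \<sigma> p = (let s = cvec \<circ> \<sigma> in vec.span {s p, d_z s p, d_zbar s p})"

definition csc :: "(complex \<Rightarrow> real ^ 5) \<Rightarrow> complex \<Rightarrow> (complex ^ 5) set" where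
  "csc \<sigma> p = (let s = cvec \<circ> \<sigma> in vec.span {s p, d_z s p, d_zbar s p, d_zbar (d_z s) p})"

definition covD :: "(complex \<Rightarrow> real ^ 5) \<Rightarrow> complex \<Rightarrow> (complex \<Rightarrow> complex ^ 5)
    \<Rightarrow> complex \<Rightarrow> complex ^ 5" where
  "covD \<sigma> X f p =
     proj_on (csc \<sigma> p) (dir (\<lambda>y. proj_on (csc \<sigma> y) (f y)) p X) +
     proj_perp (csc \<sigma> p) (dir (\<lambda>y. proj_perp (csc \<sigma> y) (f y)) p X)"

text \<open>\<open>\<N> = d - \<D>\<close> is tensorial, so it is determined by its values on constant sections.\<close>

definition formN :: "(complex \<Rightarrow> real ^ 5) \<Rightarrow> complex \<Rightarrow> complex \<Rightarrow> complex ^ 5 ^ 5" where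
  "formN \<sigma> p X = matrix (\<lambda>w. dir (\<lambda>_. w) p X - covD \<sigma> X (\<lambda>_. w) p)"


section \<open>Endomorphism-valued forms\<close>

definition mscale :: "complex \<Rightarrow> complex ^ 5 ^ 5 \<Rightarrow> complex ^ 5 ^ 5" where
  "mscale c B = (\<chi> i j. c * B $ i $ j)"

definition form10 :: "(complex \<Rightarrow> complex \<Rightarrow> complex ^ 5 ^ 5) \<Rightarrow> complex \<Rightarrow> complex \<Rightarrow> complex ^ 5 ^ 5"
  where "form10 \<omega> p X = mscale (1/2) (\<omega> p X - mscale \<i> (\<omega> p (\<i> * X)))"

definition form01 :: "(complex \<Rightarrow> complex \<Rightarrow> complex ^ 5 ^ 5) \<Rightarrow> complex \<Rightarrow> complex \<Rightarrow> complex ^ 5 ^ 5"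
  where "form01 \<omega> p X = mscale (1/2) (\<omega> p X + mscale \<i> (\<omega> p (\<i> * X)))"

definition star :: "(complex \<Rightarrow> complex \<Rightarrow> complex ^ 5 ^ 5) \<Rightarrow> complex \<Rightarrow> complex \<Rightarrow> complex ^ 5 ^ 5"
  where "star \<omega> p X = - \<omega> p (\<i> * X)"

definition bracket_wedge :: "(complex \<Rightarrow> complex \<Rightarrow> complex ^ 5 ^ 5)
    \<Rightarrow> (complex \<Rightarrow> complex \<Rightarrow> complex ^ 5 ^ 5) \<Rightarrow> complex \<Rightarrow> complex \<Rightarrow> complex \<Rightarrow> complex ^ 5 ^ 5" where
  "bracket_wedge \<mu> \<eta> p X Y =
     (\<mu> p X ** \<eta> p Y - \<eta> p Y ** \<mu> p X) - (\<mu> p Y ** \<eta> p X - \<eta> p X ** \<mu> p Y)"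

text \<open>The connection induced by \<open>\<D>\<close> on endomorphisms,
  \<open>(\<D>\<^sub>X B) w = \<D>\<^sub>X (B w) - B (\<D>\<^sub>X w)\<close>, evaluated on constant sections \<open>w\<close>, and its exterior
  derivative, evaluated on constant vector fields \<open>X\<close>, \<open>Y\<close> (which commute).\<close>

definition covD_end :: "(complex \<Rightarrow> real ^ 5) \<Rightarrow> complex \<Rightarrow> (complex \<Rightarrow> complex ^ 5 ^ 5)
    \<Rightarrow> complex \<Rightarrow> complex ^ 5 ^ 5" where
  "covD_end \<sigma> X B p = matrix (\<lambda>w. covD \<sigma> X (\<lambda>y. B y *v w) p - B p *v covD \<sigma> X (\<lambda>_. w) p)"

definition ext_covD :: "(complex \<Rightarrow> real ^ 5) \<Rightarrow> (complex \<Rightarrow> complex \<Rightarrow> complex ^ 5 ^ 5)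
    \<Rightarrow> complex \<Rightarrow> complex \<Rightarrow> complex \<Rightarrow> complex ^ 5 ^ 5" where
  "ext_covD \<sigma> \<omega> p X Y =
     covD_end \<sigma> X (\<lambda>y. \<omega> y Y) p - covD_end \<sigma> Y (\<lambda>y. \<omega> y X) p"


section \<open>Constrained Willmore surfaces, conserved quantities, constant mean curvature\<close>

text \<open>Real smooth 1-forms with values in \<open>\<Lambda> \<and> \<Lambda>\<^sup>(\<^sup>1\<^sup>)\<close>; as \<open>\<Lambda>\<close> has rank 1, every element of
  this bundle is of the form \<open>\<sigma> \<and> \<xi>\<close>.\<close>

definition real_form :: "complex set \<Rightarrow> (complex \<Rightarrow> real ^ 5)
    \<Rightarrow> (complex \<Rightarrow> complex \<Rightarrow> complex ^ 5 ^ 5) \<Rightarrow> bool" where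
  "real_form D \<sigma> q \<longleftrightarrow>
     (\<forall>X. smooth_on D (\<lambda>p. q p X)) \<and>
     (\<forall>p\<in>D. linear (q p) \<and>
        (\<forall>X. (\<exists>\<xi>\<in>Lambda1 \<sigma> p. q p X = wedge (cvec (\<sigma> p)) \<xi>) \<and> (\<forall>i j. q p X $ i $ j \<in> \<real>)))"

definition multiplier :: "complex set \<Rightarrow> (complex \<Rightarrow> real ^ 5)
    \<Rightarrow> (complex \<Rightarrow> complex \<Rightarrow> complex ^ 5 ^ 5) \<Rightarrow> bool" where
  "multiplier D \<sigma> q \<longleftrightarrow> real_form D \<sigma> q \<and>
     (\<forall>p\<in>D. \<forall>X Y. ext_covD \<sigma> q p X Y = 0 \<and>
        ext_covD \<sigma> (star (formN \<sigma>)) p X Y = mscale 2 (bracket_wedge q (star (formN \<sigma>)) p X Y))"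

definition constrained_Willmore :: "complex set \<Rightarrow> (complex \<Rightarrow> real ^ 5) \<Rightarrow> bool" where
  "constrained_Willmore D \<sigma> \<longleftrightarrow> (\<exists>q. multiplier D \<sigma> q)"

text \<open>The connection \<open>d\<^sub>S\<^sup>\<zeta>\<^sup>,\<^sup>q\<close>, in the direction \<open>X\<close>, on a section \<open>f\<close>; the spectral
  parameter is written \<open>\<zeta>\<close>.\<close>

definition conn :: "(complex \<Rightarrow> real ^ 5) \<Rightarrow> (complex \<Rightarrow> complex \<Rightarrow> complex ^ 5 ^ 5) \<Rightarrow> complex
    \<Rightarrow> complex \<Rightarrow> (complex \<Rightarrow> complex ^ 5) \<Rightarrow> complex \<Rightarrow> complex ^ 5" where
  "conn \<sigma> q \<zeta> X f p =
     covD \<sigma> X f p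
     + inverse \<zeta> *s (form10 (formN \<sigma>) p X *v f p)
     + \<zeta> *s (form01 (formN \<sigma>) p X *v f p)
     + ((inverse \<zeta>)\<^sup>2 - 1) *s (form10 q p X *v f p)
     + (\<zeta>\<^sup>2 - 1) *s (form01 q p X *v f p)"

definition laurent :: "(complex \<Rightarrow> complex ^ 5) \<Rightarrow> (complex \<Rightarrow> complex ^ 5) \<Rightarrow> complex
    \<Rightarrow> complex \<Rightarrow> complex ^ 5" where
  "laurent v v0 \<zeta> p = inverse \<zeta> *s v p + v0 p + \<zeta> *s cnjv (v p)"

definition conserved_quantity :: "complex set \<Rightarrow> (complex \<Rightarrow> real ^ 5)
    \<Rightarrow> (complex \<Rightarrow> complex \<Rightarrow> complex ^ 5 ^ 5)
    \<Rightarrow> (complex \<Rightarrow> complex ^ 5) \<Rightarrow> (complex \<Rightarrow> complex ^ 5) \<Rightarrow> bool" where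
  "conserved_quantity D \<sigma> q v v0 \<longleftrightarrow>
     smooth_on D v \<and> smooth_on D v0 \<and>
     (\<forall>p\<in>D. v0 p \<in> csc \<sigma> p \<and> cnjv (v0 p) = v0 p) \<and>
     (\<forall>p\<in>D. \<forall>y\<in>csc \<sigma> p. lor (v p) y = 0) \<and>
     (\<exists>p\<in>D. laurent v v0 1 p \<noteq> 0) \<and>
     (\<forall>\<zeta>. \<zeta> \<noteq> 0 \<longrightarrow> (\<forall>p\<in>D. \<forall>X. conn \<sigma> q \<zeta> X (laurent v v0 \<zeta>) p = 0))"

text \<open>Constancy of the squared mean curvature in the space-form determined by \<open>vinf\<close>.\<close>

definition CMC_in :: "complex set \<Rightarrow> (complex \<Rightarrow> real ^ 5) \<Rightarrow> real ^ 5 \<Rightarrow> bool" where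
  "CMC_in D \<sigma> vinf \<longleftrightarrow>
     (\<lambda>p. let n = proj_perp (csc \<sigma> p) (cvec vinf) in lor n n) constant_on D"

end

theory Submission
  imports Defs
begin

text \<open>Locally \<open>S\<close> is the orthogonal complement of a real unit normal \<open>n\<close>, and then
  \<open>\<N> = n \<and> dn\<close>.

  If \<open>p(\<zeta>) = \<zeta>\<inverse> v + v\<^sub>0 + \<zeta> v'\<close>, \<open>v'\<close> the conjugate of \<open>v\<close>, is a conserved quantity, then
  \<open>v\<^sub>\<infinity> = p(1)\<close> is a constant real vector, and \<open>(p(\<zeta>), p(\<zeta>))\<close> is constant on the surface for every
  \<open>\<zeta>\<close>, because the connections are metric. Comparing values of \<open>\<zeta>\<close>, \<open>(v, v) = f\<^sup>2\<close> is constant,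
  where \<open>v = f n\<close>. Hence \<open>|f|\<^sup>2 = |f\<^sup>2|\<close> is constant, and so is the square of
  \<open>(v\<^sub>\<infinity>, n) = 2 Re f\<close>.

  Conversely, let \<open>H = (v\<^sub>\<infinity>, n)\<close> be constant. Scale the lift such that \<open>(v\<^sub>\<infinity>, \<sigma>) = -1\<close>. Then
  \<open>dn\<close> is a trace-free symmetric combination of the derivatives of \<open>\<sigma>\<close>, and \<open>n\<close> satisfies
  \<open>\<Delta>n = - |dn|\<^sup>2 (n + H \<sigma>)\<close>. These two facts are the multiplier equations for
  \<open>q = (H/2) \<sigma> \<and> dn\<close>, and \<open>v = (H/2) n\<close>, \<open>v\<^sub>0 = v\<^sub>\<infinity> - H n\<close> define a conserved quantity. If the
  lift cannot be scaled on any open subset, then \<open>v\<^sub>\<infinity>\<close> is a multiple of \<open>n\<close>, so \<open>n\<close> is constant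
  and the same formulas, now with \<open>q = 0\<close>, apply.\<close>

section \<open>Smooth functions on the plane\<close>

lemma dir_eqI: "(f has_derivative f') (at p) \<Longrightarrow> dir f p X = f' X"
  unfolding dir_def using frechet_derivative_at by metis

lemma has_derivative_dir: "f differentiable (at p) \<Longrightarrow> (f has_derivative dir f p) (at p)"
  unfolding dir_def by (simp add: frechet_derivative_works)

lemma linear_dir: "f differentiable (at p) \<Longrightarrow> linear (dir f p)"
  using has_derivative_dir has_derivative_linear by blast

lemma dir_combine:
  fixes f :: "complex \<Rightarrow> 'b::real_normed_vector"
  assumes "f differentiable (at p)"
  shows "dir f p X = Re X *\<^sub>R dir f p 1 + Im X *\<^sub>R dir f p \<i>"
proof -
  interpret linear "dir f p" by (rule linear_dir[OF assms])
  have "dir f p X = dir f p (Re X *\<^sub>R 1 + Im X *\<^sub>R \<i>)"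
    by (rule arg_cong[where f = "dir f p"]) (simp add: complex_eq_iff)
  then show ?thesis by (simp add: add scale)
qed

lemma has_derivative_cong_open:
  assumes "open D" "p \<in> D" "\<And>y. y \<in> D \<Longrightarrow> f y = g y"
  shows "(f has_derivative f') (at p) \<longleftrightarrow> (g has_derivative f') (at p)"
  using assms has_derivative_transform_within_open[of f f' p UNIV D g]
    has_derivative_transform_within_open[of g f' p UNIV D f] by metis

lemma dir_cong_open:
  assumes "open D" "p \<in> D" "\<And>y. y \<in> D \<Longrightarrow> f y = g y"
  shows "dir f p X = dir g p X"
  unfolding dir_def frechet_derivative_def
  using has_derivative_cong_open[OF assms] by simp

lemma differentiable_cong_open:
  assumes "open D" "p \<in> D" "\<And>y. y \<in> D \<Longrightarrow> f y = g y" "f differentiable (at p)"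
  shows "g differentiable (at p)"
  using assms(4) has_derivative_cong_open[where f = f and g = g, OF assms(1-3)]
  unfolding differentiable_def by blast

lemma dir_const [simp]: "dir (\<lambda>_. c) p X = 0"
  by (rule dir_eqI) (rule has_derivative_const)

lemma dir_add:
  assumes "f differentiable (at p)" "g differentiable (at p)"
  shows "dir (\<lambda>y. f y + g y) p X = dir f p X + dir g p X"
  by (rule dir_eqI) (intro has_derivative_add has_derivative_dir assms)

lemma dir_diff:
  assumes "f differentiable (at p)" "g differentiable (at p)"
  shows "dir (\<lambda>y. f y - g y) p X = dir f p X - dir g p X"
  by (rule dir_eqI) (intro has_derivative_diff has_derivative_dir assms)

lemma dir_bounded_linear:
  assumes "bounded_linear h" "f differentiable (at p)"
  shows "dir (\<lambda>y. h (f y)) p X = h (dir f p X)"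
  by (rule dir_eqI) (intro bounded_linear.has_derivative[OF assms(1)] has_derivative_dir assms)

lemma differentiable_bounded_linear:
  assumes "bounded_linear h" "f differentiable (at p)"
  shows "(\<lambda>y. h (f y)) differentiable (at p)"
  using bounded_linear.has_derivative[OF assms(1)] assms(2) unfolding differentiable_def by blast

lemma dir_bounded_bilinear:
  assumes "bounded_bilinear h" "f differentiable (at p)" "g differentiable (at p)"
  shows "dir (\<lambda>y. h (f y) (g y)) p X = h (f p) (dir g p X) + h (dir f p X) (g p)"
  by (rule dir_eqI) (intro bounded_bilinear.FDERIV[OF assms(1)] has_derivative_dir assms)

lemma differentiable_bounded_bilinear:
  assumes "bounded_bilinear h" "f differentiable (at p)" "g differentiable (at p)"
  shows "(\<lambda>y. h (f y) (g y)) differentiable (at p)"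
  using bounded_bilinear.FDERIV[OF assms(1)] assms(2-) unfolding differentiable_def by blast

section \<open>Closure properties of \<open>Ck_on\<close> and \<open>smooth_on\<close>\<close>

lemma Ck_on_cong:
  assumes "open D" "\<And>y. y \<in> D \<Longrightarrow> f y = g y" "Ck_on k D f"
  shows "Ck_on k D g"
  using assms(2,3)
proof (induction k arbitrary: f g)
  case 0
  then show ?case by (simp cong: continuous_on_cong)
next
  case (Suc k)
  have "Ck_on k D (\<lambda>p. dir g p X)" for X
    by (rule Suc.IH[where f = "\<lambda>p. dir f p X"])
       (use Suc.prems dir_cong_open[OF assms(1), of _ f g] in auto)
  then show ?case
    using Suc.prems differentiable_cong_open[OF assms(1), of _ f g] by auto
qed

lemma Ck_on_subset: "Ck_on k D f \<Longrightarrow> E \<subseteq> D \<Longrightarrow> Ck_on k E f"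
  by (induction k arbitrary: f) (auto intro: continuous_on_subset)

lemma Ck_on_SucD: "Ck_on (Suc k) D f \<Longrightarrow> Ck_on k D f"
proof (induction k arbitrary: f)
  case 0
  then show ?case
    by (auto intro!: continuous_at_imp_continuous_on differentiable_imp_continuous_within)
next
  case (Suc k)
  then show ?case by (metis Ck_on.simps(2))
qed

lemma Ck_on_const: "Ck_on k D (\<lambda>_. c)"
  by (induction k arbitrary: c) auto

lemma Ck_on_add:
  assumes "open D" "Ck_on k D f" "Ck_on k D g"
  shows "Ck_on k D (\<lambda>p. f p + g p)"
  using assms(2,3)
proof (induction k arbitrary: f g)
  case 0
  then show ?case by (auto intro: continuous_intros)
next
  case (Suc k)
  have "Ck_on k D (\<lambda>p. dir (\<lambda>p. f p + g p) p X)" for X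
    by (rule Ck_on_cong[OF assms(1), where f = "\<lambda>p. dir f p X + dir g p X"])
       (use Suc dir_add in \<open>auto simp: dir_add\<close>)
  then show ?case using Suc.prems by auto
qed

lemma Ck_on_bounded_linear:
  assumes "open D" "bounded_linear h" "Ck_on k D f"
  shows "Ck_on k D (\<lambda>p. h (f p))"
  using assms(3)
proof (induction k arbitrary: f)
  case 0
  then show ?case by (auto intro: bounded_linear.continuous_on[OF assms(2)])
next
  case (Suc k)
  have "Ck_on k D (\<lambda>p. dir (\<lambda>p. h (f p)) p X)" for X
    by (rule Ck_on_cong[OF assms(1), where f = "\<lambda>p. h (dir f p X)"])
       (use Suc in \<open>auto simp: dir_bounded_linear[OF assms(2)]\<close>)
  then show ?case
    using Suc.prems by (auto intro: differentiable_bounded_linear[OF assms(2)])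
qed

lemma Ck_on_bounded_bilinear:
  assumes "open D" "bounded_bilinear h" "Ck_on k D f" "Ck_on k D g"
  shows "Ck_on k D (\<lambda>p. h (f p) (g p))"
  using assms(3,4)
proof (induction k arbitrary: f g)
  case 0
  then show ?case by (auto intro: bounded_bilinear.continuous_on[OF assms(2)])
next
  case (Suc k)
  have k: "Ck_on k D f" "Ck_on k D g"
    using Suc.prems by (auto intro: Ck_on_SucD simp del: Ck_on.simps)
  have "Ck_on k D (\<lambda>p. dir (\<lambda>p. h (f p) (g p)) p X)" for X
  proof (rule Ck_on_cong[OF assms(1), where f = "\<lambda>p. h (f p) (dir g p X) + h (dir f p X) (g p)"])
    show "Ck_on k D (\<lambda>p. h (f p) (dir g p X) + h (dir f p X) (g p))"
      using Suc k by (intro Ck_on_add[OF assms(1)] Suc.IH) auto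
  qed (use Suc.prems in \<open>auto simp: dir_bounded_bilinear[OF assms(2)]\<close>)
  then show ?case
    using Suc.prems by (auto intro: differentiable_bounded_bilinear[OF assms(2)])
qed

text \<open>The factor f^(-3/2) is written as a cube of \<open>1 / sqrt (f p)\<close>, so that the
  induction hypothesis in \<open>Ck_on_inverse_sqrt\<close> applies to each factor of the
  derivative.\<close>

lemma has_derivative_inverse_sqrt:
  fixes f :: "complex \<Rightarrow> real"
  assumes "f differentiable (at p)" "0 < f p"
  shows "((\<lambda>y. 1 / sqrt (f y)) has_derivative
    (\<lambda>X. (-1/2) * ((1 / sqrt (f p)) * ((1 / sqrt (f p)) * (1 / sqrt (f p)))) * dir f p X)) (at p)"
proof -
  have "((\<lambda>x. 1 / sqrt x) has_real_derivative
      (-1/2) * ((1 / sqrt (f p)) * ((1 / sqrt (f p)) * (1 / sqrt (f p))))) (at (f p))"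
    using assms(2) by (auto intro!: derivative_eq_intros simp: field_simps)
  from has_derivative_compose[OF has_derivative_dir[OF assms(1)]
      this[unfolded has_field_derivative_def]]
  show ?thesis by (simp add: mult.commute)
qed

lemma Ck_on_mult:
  fixes f g :: "complex \<Rightarrow> real"
  assumes "open D" "Ck_on k D f" "Ck_on k D g"
  shows "Ck_on k D (\<lambda>p. f p * g p)"
  by (rule Ck_on_bounded_bilinear[OF assms(1) bounded_bilinear_mult assms(2,3)])

lemma Ck_on_inverse_sqrt:
  fixes f :: "complex \<Rightarrow> real"
  assumes "open D" "\<And>p. p \<in> D \<Longrightarrow> 0 < f p" "Ck_on k D f"
  shows "Ck_on k D (\<lambda>p. 1 / sqrt (f p))"
  using assms(3)
proof (induction k)
  case 0
  then show ?case using assms(2) by (force intro!: continuous_intros)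
next
  case (Suc k)
  have IH: "Ck_on k D (\<lambda>p. 1 / sqrt (f p))"
    using Suc Ck_on_SucD by blast
  have "Ck_on k D (\<lambda>p. dir (\<lambda>p. 1 / sqrt (f p)) p X)" for X
  proof (rule Ck_on_cong[OF assms(1), where f = "\<lambda>p.
      (-1/2) * ((1 / sqrt (f p)) * ((1 / sqrt (f p)) * (1 / sqrt (f p)))) * dir f p X"])
    show "Ck_on k D (\<lambda>p. (-1/2) * ((1 / sqrt (f p)) * ((1 / sqrt (f p)) * (1 / sqrt (f p))))
        * dir f p X)"
      using Suc IH by (intro Ck_on_mult[OF assms(1)] Ck_on_const) auto
  qed (use Suc.prems assms(2) in \<open>auto simp: dir_eqI[OF has_derivative_inverse_sqrt]\<close>)
  then show ?case
    using Suc.prems has_derivative_inverse_sqrt assms(2) unfolding Ck_on.simps differentiable_def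
    by meson
qed

lemma smooth_on_cong: "open D \<Longrightarrow> (\<And>y. y \<in> D \<Longrightarrow> f y = g y) \<Longrightarrow> smooth_on D f \<Longrightarrow> smooth_on D g"
  unfolding smooth_on_def using Ck_on_cong by blast

lemma smooth_on_subset: "smooth_on D f \<Longrightarrow> E \<subseteq> D \<Longrightarrow> smooth_on E f"
  unfolding smooth_on_def using Ck_on_subset by blast

lemma smooth_on_const: "smooth_on D (\<lambda>_. c)"
  unfolding smooth_on_def using Ck_on_const by blast

lemma smooth_on_add:
  "open D \<Longrightarrow> smooth_on D f \<Longrightarrow> smooth_on D g \<Longrightarrow> smooth_on D (\<lambda>p. f p + g p)"
  unfolding smooth_on_def using Ck_on_add by blast

lemma smooth_on_bounded_linear:
  "open D \<Longrightarrow> bounded_linear h \<Longrightarrow> smooth_on D f \<Longrightarrow> smooth_on D (\<lambda>p. h (f p))"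
  unfolding smooth_on_def using Ck_on_bounded_linear by blast

lemma smooth_on_bounded_bilinear:
  "open D \<Longrightarrow> bounded_bilinear h \<Longrightarrow> smooth_on D f \<Longrightarrow> smooth_on D g
    \<Longrightarrow> smooth_on D (\<lambda>p. h (f p) (g p))"
  unfolding smooth_on_def using Ck_on_bounded_bilinear by blast

lemma smooth_on_mult:
  fixes f g :: "complex \<Rightarrow> real"
  shows "open D \<Longrightarrow> smooth_on D f \<Longrightarrow> smooth_on D g \<Longrightarrow> smooth_on D (\<lambda>p. f p * g p)"
  unfolding smooth_on_def using Ck_on_mult by blast

lemma smooth_on_scaleR:
  "open D \<Longrightarrow> smooth_on D f \<Longrightarrow> smooth_on D g \<Longrightarrow> smooth_on D (\<lambda>p. f p *\<^sub>R g p)"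
  by (rule smooth_on_bounded_bilinear[OF _ bounded_bilinear_scaleR])

lemma smooth_on_diff:
  assumes "open D" "smooth_on D f" "smooth_on D g"
  shows "smooth_on D (\<lambda>p. f p - g p)"
  using smooth_on_add[OF assms(1,2) smooth_on_bounded_linear[OF assms(1)
    bounded_linear_minus[OF bounded_linear_ident] assms(3)]] by simp

lemma smooth_on_inverse_sqrt:
  fixes f :: "complex \<Rightarrow> real"
  shows "open D \<Longrightarrow> (\<And>p. p \<in> D \<Longrightarrow> 0 < f p) \<Longrightarrow> smooth_on D f \<Longrightarrow> smooth_on D (\<lambda>p. 1 / sqrt (f p))"
  unfolding smooth_on_def using Ck_on_inverse_sqrt by blast

text \<open>1/f is f times the square of 1/sqrt(f^2). The argument of the root is positive whatever
  the sign of f, which reduces the claim to \<open>smooth_on_inverse_sqrt\<close>.\<close>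

lemma smooth_on_inverse:
  fixes f :: "complex \<Rightarrow> real"
  assumes D: "open D" and nz: "\<And>p. p \<in> D \<Longrightarrow> f p \<noteq> 0" and f: "smooth_on D f"
  shows "smooth_on D (\<lambda>p. inverse (f p))"
proof (rule smooth_on_cong[OF D])
  have "smooth_on D (\<lambda>p. 1 / sqrt (f p * f p))"
    using nz by (intro smooth_on_inverse_sqrt smooth_on_mult D f) (metis mult_eq_0_iff zero_less_mult_iff not_real_square_gt_zero)
  then show "smooth_on D (\<lambda>p. f p * ((1 / sqrt (f p * f p)) * (1 / sqrt (f p * f p))))"
    by (intro smooth_on_mult D f)
qed (use nz in \<open>auto simp: field_simps\<close>)

lemma smooth_on_differentiable: "smooth_on D f \<Longrightarrow> p \<in> D \<Longrightarrow> f differentiable (at p)"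
  unfolding smooth_on_def by (metis Ck_on.simps(2))

lemma smooth_on_dir: "smooth_on D f \<Longrightarrow> smooth_on D (\<lambda>p. dir f p X)"
  unfolding smooth_on_def by (metis Ck_on.simps(2))

lemma smooth_on_continuous_on: "smooth_on D f \<Longrightarrow> continuous_on D f"
  unfolding smooth_on_def by (metis Ck_on.simps(1))

section \<open>Symmetry of mixed second derivatives\<close>

lemma mvt_dir:
  fixes g :: "complex \<Rightarrow> real"
  assumes "0 < h" "\<And>t. 0 \<le> t \<Longrightarrow> t \<le> h \<Longrightarrow> g differentiable (at (p + t *\<^sub>R X))"
  obtains t where "0 < t" "t < h" "g (p + h *\<^sub>R X) - g p = h * dir g (p + t *\<^sub>R X) X"
proof -
  have "((\<lambda>t. g (p + t *\<^sub>R X)) has_derivative (\<lambda>s. dir g (p + t *\<^sub>R X) (s *\<^sub>R X)))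
      (at t within {0..h})" if "0 \<le> t" "t \<le> h" for t
    by (rule has_derivative_compose[where g = g and f = "\<lambda>t. p + t *\<^sub>R X",
          OF _ has_derivative_dir[OF assms(2)[OF that]]])
       (auto intro!: derivative_eq_intros)
  from mvt_simple[of 0 h "\<lambda>t. g (p + t *\<^sub>R X)" "\<lambda>t s. dir g (p + t *\<^sub>R X) (s *\<^sub>R X)", OF assms(1) this]
  obtain t where t: "t \<in> {0<..<h}"
    "g (p + h *\<^sub>R X) - g (p + 0 *\<^sub>R X) = dir g (p + t *\<^sub>R X) ((h - 0) *\<^sub>R X)"
    by (auto simp: greaterThanLessThan_iff)
  moreover have "linear (dir g (p + t *\<^sub>R X))" using t by (intro linear_dir assms(2)) auto
  ultimately show thesis
    using that[of t] by (simp add: linear_scale)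
qed

text \<open>The second difference of \<open>g\<close> along \<open>X\<close> and \<open>Y\<close> is \<open>h\<^sup>2\<close> times a mixed second derivative
  at a nearby point, and it is symmetric in \<open>X\<close> and \<open>Y\<close>.\<close>

lemma second_difference:
  fixes g :: "complex \<Rightarrow> real"
  assumes "0 < h" "\<And>s t. 0 \<le> s \<Longrightarrow> s \<le> h \<Longrightarrow> 0 \<le> t \<Longrightarrow> t \<le> h \<Longrightarrow> p + s *\<^sub>R X + t *\<^sub>R Y \<in> D"
    and "smooth_on D g"
  obtains s t where "0 < s" "s < h" "0 < t" "t < h"
    "g (p + h *\<^sub>R X + h *\<^sub>R Y) - g (p + h *\<^sub>R X) - g (p + h *\<^sub>R Y) + g p
      = h * (h * dir (\<lambda>y. dir g y X) (p + s *\<^sub>R X + t *\<^sub>R Y) Y)"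
proof -
  have shift: "((\<lambda>y. g (y + c)) has_derivative dir g (y + c)) (at y)" if "y + c \<in> D" for y c
    by (rule has_derivative_compose[where g = g and f = "\<lambda>y. y + c",
          OF _ has_derivative_dir[OF smooth_on_differentiable[OF assms(3) that]]])
       (auto intro!: derivative_eq_intros)
  \<comment> \<open>The mean value theorem is used twice: along X for the difference of g across h
    Y, then along Y for the X-derivative of g. The summand \<open>0 *\<^sub>R Y\<close> gives both
    terms the shape of \<open>shift\<close>.\<close>
  let ?G = "\<lambda>y. g (y + h *\<^sub>R Y) - g (y + 0 *\<^sub>R Y)"
  have dG: "(?G has_derivative (\<lambda>Z. dir g (p + s *\<^sub>R X + h *\<^sub>R Y) Z - dir g (p + s *\<^sub>R X + 0 *\<^sub>R Y) Z))
      (at (p + s *\<^sub>R X))" if "0 \<le> s" "s \<le> h" for s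
    using assms(1) assms(2)[of s 0] assms(2)[of s h] that by (intro has_derivative_diff shift) auto
  obtain s where s: "0 < s" "s < h" "?G (p + h *\<^sub>R X) - ?G p = h * dir ?G (p + s *\<^sub>R X) X"
    using mvt_dir[OF assms(1), of ?G p X] dG unfolding differentiable_def by blast
  have dd: "(\<lambda>y. dir g y X) differentiable (at (p + s *\<^sub>R X + t *\<^sub>R Y))" if "0 \<le> t" "t \<le> h" for t
    using smooth_on_differentiable[OF smooth_on_dir[OF assms(3)]] assms(2) that s by auto
  obtain t where t: "0 < t" "t < h"
    "dir g (p + s *\<^sub>R X + h *\<^sub>R Y) X - dir g (p + s *\<^sub>R X) X
      = h * dir (\<lambda>y. dir g y X) (p + s *\<^sub>R X + t *\<^sub>R Y) Y"
    using mvt_dir[OF assms(1), of "\<lambda>y. dir g y X" "p + s *\<^sub>R X" Y] dd by blast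
  have "dir ?G (p + s *\<^sub>R X) X = dir g (p + s *\<^sub>R X + h *\<^sub>R Y) X - dir g (p + s *\<^sub>R X) X"
    using dir_eqI[OF dG[of s]] s by simp
  with s t show thesis
    using that[of s t] by (simp add: algebra_simps)
qed

text \<open>The same second difference is h^2 times either mixed derivative, taken at some point of
  the parallelogram spanned by hX and hY at p. For small h, continuity keeps both values within half
  the supposed gap of their values at p, yet they are equal.\<close>

lemma second_dir_symmetric_real:
  fixes g :: "complex \<Rightarrow> real"
  assumes D: "open D" "p \<in> D" and g: "smooth_on D g"
  shows "dir (\<lambda>y. dir g y X) p Y = dir (\<lambda>y. dir g y Y) p X" (is "?a p = ?b p")
proof (rule ccontr)
  assume ne: "?a p \<noteq> ?b p"
  define e where "e = \<bar>?a p - ?b p\<bar> / 2"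
  have e: "0 < e" using ne by (simp add: e_def)
  have cont: "continuous_on D ?a" "continuous_on D ?b"
    by (intro smooth_on_continuous_on smooth_on_dir g)+
  obtain r where r: "0 < r" "ball p r \<subseteq> D" using D openE by blast
  obtain d1 where d1: "0 < d1" "\<And>y. y \<in> D \<Longrightarrow> dist y p < d1 \<Longrightarrow> dist (?a y) (?a p) < e"
    using cont(1) D e unfolding continuous_on_iff by metis
  obtain d2 where d2: "0 < d2" "\<And>y. y \<in> D \<Longrightarrow> dist y p < d2 \<Longrightarrow> dist (?b y) (?b p) < e"
    using cont(2) D e unfolding continuous_on_iff by metis
  define d where "d = min r (min d1 d2)"
  \<comment> \<open>This scale keeps the whole parallelogram within distance d of p; the summand 1
    keeps the denominator positive when X and Y vanish.\<close>
  define h where "h = d / (norm X + norm Y + 1)"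
  have d: "0 < d" using r d1 d2 by (simp add: d_def)
  have pos: "0 < norm X + norm Y + 1" by (smt (verit) norm_ge_zero)
  have h: "0 < h" using d pos by (simp add: h_def)
  have near: "dist (p + s *\<^sub>R X + t *\<^sub>R Y) p < d"
    if "0 \<le> s" "s \<le> h" "0 \<le> t" "t \<le> h" for s t
  proof -
    have "dist (p + s *\<^sub>R X + t *\<^sub>R Y) p = norm (s *\<^sub>R X + t *\<^sub>R Y)" by (simp add: dist_norm)
    also have "\<dots> \<le> s * norm X + t * norm Y" using that by (metis abs_of_nonneg norm_scaleR norm_triangle_ineq)
    also have "\<dots> \<le> h * norm X + h * norm Y" using that by (intro add_mono mult_right_mono) auto
    also have "\<dots> < h * (norm X + norm Y + 1)" using h by (simp add: algebra_simps)
    also have "\<dots> = d" using pos by (simp add: h_def)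
    finally show ?thesis .
  qed
  have inD: "p + s *\<^sub>R X + t *\<^sub>R Y \<in> D" if "0 \<le> s" "s \<le> h" "0 \<le> t" "t \<le> h" for s t
    using near[OF that] r by (auto simp: d_def dist_commute subset_iff)
  obtain s t where st: "0 < s" "s < h" "0 < t" "t < h"
    "g (p + h *\<^sub>R X + h *\<^sub>R Y) - g (p + h *\<^sub>R X) - g (p + h *\<^sub>R Y) + g p
      = h * (h * ?a (p + s *\<^sub>R X + t *\<^sub>R Y))"
    using second_difference[OF h inD g] by blast
  have inD': "p + s *\<^sub>R Y + t *\<^sub>R X \<in> D" if "0 \<le> s" "s \<le> h" "0 \<le> t" "t \<le> h" for s t
    using inD[OF that(3,4,1,2)] by (simp add: add_ac)
  obtain s' t' where st': "0 < s'" "s' < h" "0 < t'" "t' < h"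
    "g (p + h *\<^sub>R Y + h *\<^sub>R X) - g (p + h *\<^sub>R Y) - g (p + h *\<^sub>R X) + g p
      = h * (h * ?b (p + s' *\<^sub>R Y + t' *\<^sub>R X))"
    using second_difference[OF h inD' g] by blast
  have "h * (h * ?a (p + s *\<^sub>R X + t *\<^sub>R Y)) = h * (h * ?b (p + s' *\<^sub>R Y + t' *\<^sub>R X))"
    unfolding st(5)[symmetric] st'(5)[symmetric] by (simp add: algebra_simps)
  then have eq: "?a (p + s *\<^sub>R X + t *\<^sub>R Y) = ?b (p + t' *\<^sub>R X + s' *\<^sub>R Y)"
    using h by (simp add: add_ac)
  have "dist (?a (p + s *\<^sub>R X + t *\<^sub>R Y)) (?a p) < e" "dist (?b (p + t' *\<^sub>R X + s' *\<^sub>R Y)) (?b p) < e"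
    using near inD st st' by (auto intro!: d1(2) d2(2) simp: d_def less_imp_le)
  then show False using eq unfolding e_def dist_real_def by (smt (verit) field_sum_of_halves)
qed

lemma second_dir_symmetric:
  fixes f :: "complex \<Rightarrow> 'b::euclidean_space"
  assumes D: "open D" "p \<in> D" and f: "smooth_on D f"
  shows "dir (\<lambda>y. dir f y X) p Y = dir (\<lambda>y. dir f y Y) p X"
proof (rule euclidean_eqI)
  fix b :: 'b
  have bl: "bounded_linear (\<lambda>v. v \<bullet> b)" by (rule bounded_linear_inner_left)
  have 1: "dir (\<lambda>y. dir (\<lambda>x. f x \<bullet> b) y Z) p W = dir (\<lambda>y. dir f y Z) p W \<bullet> b" for Z W
  proof -
    have "dir (\<lambda>y. dir (\<lambda>x. f x \<bullet> b) y Z) p W = dir (\<lambda>y. dir f y Z \<bullet> b) p W"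
      by (rule dir_cong_open[OF D])
         (simp add: dir_bounded_linear[OF bl smooth_on_differentiable[OF f]])
    then show ?thesis
      by (simp add: dir_bounded_linear[OF bl smooth_on_differentiable[OF smooth_on_dir[OF f] D(2)]])
  qed
  show "dir (\<lambda>y. dir f y X) p Y \<bullet> b = dir (\<lambda>y. dir f y Y) p X \<bullet> b"
    using second_dir_symmetric_real[OF D smooth_on_bounded_linear[OF D(1) bl f], of X Y]
    by (simp add: 1)
qed

lemma dir_zero_constant:
  fixes f :: "complex \<Rightarrow> 'b::real_normed_vector"
  assumes "open D" "connected D" "\<And>p. p \<in> D \<Longrightarrow> f differentiable (at p)"
    "\<And>p X. p \<in> D \<Longrightarrow> dir f p X = 0" "x \<in> D" "y \<in> D"
  shows "f x = f y"
proof -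
  have "(f has_derivative (\<lambda>_. 0)) (at p)" if "p \<in> D" for p
    using has_derivative_dir[OF assms(3)[OF that]] assms(4)[OF that] by (simp add: fun_eq_iff[symmetric] ext[of "dir f p" "\<lambda>_. 0"])
  then have "\<exists>c. \<forall>x\<in>D. f x = c"
    using has_derivative_zero_unique_connected[OF assms(1,2)] assms(5)
    by metis
  then show ?thesis using assms(5,6) by auto
qed

section \<open>Linear algebra in signature (4,1)\<close>

lemma exhaust_5:
  fixes x :: 5
  shows "x = 1 \<or> x = 2 \<or> x = 3 \<or> x = 4 \<or> x = 5"
proof (induct x)
  case (of_int k)
  then have "k = 0 \<or> k = 1 \<or> k = 2 \<or> k = 3 \<or> k = 4" by fastforce
  then show ?case by auto
qed

lemma forall_5: "(\<forall>i::5. P i) \<longleftrightarrow> P 1 \<and> P 2 \<and> P 3 \<and> P 4 \<and> P 5"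
  by (metis exhaust_5)

lemma lor_commute: "lor v w = lor w v"
  by (simp add: lor_def mult.commute)

lemma lor_add_left: "lor (v + v') w = lor v w + lor v' w"
  and lor_add_right: "lor w (v + v') = lor w v + lor w v'"
  and lor_diff_left: "lor (v - v') w = lor v w - lor v' w"
  and lor_diff_right: "lor w (v - v') = lor w v - lor w v'"
  and lor_smult_left: "lor (c *s v) w = c * lor v w"
  and lor_smult_right: "lor w (c *s v) = c * lor w v"
  and lor_minus_left: "lor (- v) w = - lor v w"
  and lor_minus_right: "lor w (- v) = - lor w v"
  by (simp_all add: lor_def algebra_simps)

lemma lor_zero_left [simp]: "lor 0 w = 0" and lor_zero_right [simp]: "lor w 0 = 0"
  by (simp_all add: lor_def)

lemma lor_scaleR_left: "lor (c *\<^sub>R v) w = c *\<^sub>R lor v w"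
  and lor_scaleR_right: "lor w (c *\<^sub>R v) = c *\<^sub>R lor w v"
  for v w :: "'a::{comm_ring_1, real_algebra_1} ^ 5"
  by (simp_all add: lor_def algebra_simps)

lemmas lor_linear = lor_add_left lor_add_right lor_diff_left lor_diff_right lor_smult_left
  lor_smult_right lor_minus_left lor_minus_right lor_scaleR_left lor_scaleR_right

lemma bounded_bilinear_lor:
  "bounded_bilinear (lor :: 'a::{comm_ring_1, real_normed_algebra_1, euclidean_space} ^ 5 \<Rightarrow> _)"
  unfolding bilinear_conv_bounded_bilinear[symmetric] bilinear_def
  by (auto intro!: linearI simp: lor_linear)

lemma bounded_bilinear_smult: "bounded_bilinear ((*s) :: complex \<Rightarrow> complex ^ 5 \<Rightarrow> _)"
  unfolding bilinear_conv_bounded_bilinear[symmetric] bilinear_def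
  by (auto intro!: linearI simp: vec_eq_iff algebra_simps)

lemma bounded_linear_smult: "bounded_linear (\<lambda>v. c *s (v :: complex ^ 5))"
  by (rule bounded_bilinear.bounded_linear_right[OF bounded_bilinear_smult])

lemma lor_nondegenerate:
  fixes v :: "'a::comm_ring_1 ^ 5"
  assumes "\<And>w. lor v w = 0"
  shows "v = 0"
proof -
  have "lor v (axis i 1) = (if i = 5 then - v $ i else v $ i)" for i
    using exhaust_5[of i] by (auto simp: lor_def axis_def)
  then show ?thesis using assms by (metis neg_equal_0_iff_equal vec_eq_iff zero_index)
qed

text \<open>Subtracting a multiple of the null vector \<open>s\<close> makes the time component of \<open>x\<close> vanish
  without changing \<open>lor x x\<close>.\<close>

lemma lor_orthogonal_null:
  fixes s x :: "real ^ 5"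
  assumes s: "lor s s = 0" "s \<noteq> 0" and x: "lor x s = 0"
  shows "0 \<le> lor x x" and "lor x x = 0 \<Longrightarrow> \<exists>c. x = c *\<^sub>R s"
proof -
  \<comment> \<open>On vectors without time component \<open>lor\<close> is positive definite, so a
    non-zero null vector must have one.\<close>
  have s5: "s $ 5 \<noteq> 0"
  proof
    assume "s $ 5 = 0"
    with s(1) have "(s$1)\<^sup>2 + (s$2)\<^sup>2 + (s$3)\<^sup>2 + (s$4)\<^sup>2 = 0"
      by (simp add: lor_def power2_eq_square)
    then have "s $ 1 = 0 \<and> s $ 2 = 0 \<and> s $ 3 = 0 \<and> s $ 4 = 0"
      by (smt (verit) power2_less_eq_zero_iff zero_le_power2)
    with \<open>s $ 5 = 0\<close> have "s = 0" by (simp add: vec_eq_iff forall_5)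
    with s(2) show False by simp
  qed
  define c where "c = x $ 5 / s $ 5"
  define y where "y = x - c *\<^sub>R s"
  have y5: "y $ 5 = 0" using s5 by (simp add: y_def c_def)
  have xy: "lor x x = lor y y"
    using s(1) x by (simp add: y_def lor_linear lor_commute[of s x])
  have yy: "lor y y = (y$1)\<^sup>2 + (y$2)\<^sup>2 + (y$3)\<^sup>2 + (y$4)\<^sup>2"
    using y5 by (simp add: lor_def power2_eq_square)
  show "0 \<le> lor x x" using xy yy by simp
  show "\<exists>c. x = c *\<^sub>R s" if "lor x x = 0"
  proof -
    have "y $ 1 = 0 \<and> y $ 2 = 0 \<and> y $ 3 = 0 \<and> y $ 4 = 0"
      using that xy yy by (smt (verit) power2_less_eq_zero_iff zero_le_power2)
    then have "y = 0" using y5 by (simp add: vec_eq_iff forall_5)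
    then show ?thesis by (auto simp: y_def)
  qed
qed

text \<open>The four products, padded with a zero, form an endomorphism of R^5 that misses
  \<open>axis 5 1\<close>. In finite dimension it therefore has a kernel.\<close>

lemma exists_orthogonal_to_four:
  fixes a b c d :: "real ^ 5"
  obtains x where "x \<noteq> 0" "lor x a = 0" "lor x b = 0" "lor x c = 0" "lor x d = 0"
proof -
  define f :: "real ^ 5 \<Rightarrow> real ^ 5" where
    "f x = (\<chi> i. if i = 1 then lor x a else if i = 2 then lor x b
       else if i = 3 then lor x c else if i = 4 then lor x d else 0)" for x
  have f: "linear f"
    by (rule linearI) (auto simp: f_def vec_eq_iff lor_linear)
  have "f x \<noteq> axis 5 1" for x
    by (auto simp: f_def vec_eq_iff axis_def intro!: exI[of _ 5])
  then have "\<not> inj f"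
    using linear_injective_imp_surjective[OF f] unfolding surj_def by (metis)
  then obtain x where x: "f x = 0" "x \<noteq> 0"
    using linear_injective_0[OF f] by blast
  then have "\<forall>i. f x $ i = 0" by simp
  then have "f x $ 1 = 0" "f x $ 2 = 0" "f x $ 3 = 0" "f x $ 4 = 0" by blast+
  then have "lor x a = 0" "lor x b = 0" "lor x c = 0" "lor x d = 0"
    by (simp_all add: f_def)
  with x that show thesis by blast
qed

text \<open>The Gram matrix of the five vectors is non-degenerate, so they form a basis.\<close>

lemma orthogonal_frame_decomposition:
  fixes s a b t n w :: "'a::field ^ 5"
  assumes u: "lor a a = u" "lor b b = u" "u \<noteq> 0" "lor t s \<noteq> 0"
    and "lor s s = 0" "lor a s = 0" "lor b s = 0" "lor a b = 0" "lor t a = 0" "lor t b = 0"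
    and "lor n s = 0" "lor n a = 0" "lor n b = 0" "lor n t = 0" "lor n n \<noteq> 0"
  obtains c1 c2 c3 c4 c5 where "w = c1 *s s + c2 *s a + c3 *s b + c4 *s t + c5 *s n"
proof -
  define T where "T c = c$1 *s s + c$2 *s a + c$3 *s b + c$4 *s t + c$5 *s n" for c :: "'a ^ 5"
  have lin: "Vector_Spaces.linear (*s) (*s) T"
    unfolding Vector_Spaces.linear_def module_hom_def module_hom_axioms_def
    by (auto simp: T_def vec_eq_iff algebra_simps vec.vector_space_axioms vec.module_axioms)
  note rel = assms assms(6-14)[unfolded lor_commute[of a s] lor_commute[of b s]
      lor_commute[of a b] lor_commute[of t a] lor_commute[of t b] lor_commute[of n s] lor_commute[of n a]
      lor_commute[of n b] lor_commute[of n t]]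
  have "c = 0" if "T c = 0" for c
  proof -
    \<comment> \<open>The system is triangular: products with n, s, a, b isolate c5, c4, c2, c3, and
      the product with t then yields c1. As \<open>lor t t\<close> is arbitrary, t may be the
      Laplacian of the lift or a vector such as \<open>vinf - H *\<^sub>R n p\<close>.\<close>
    have "lor (T c) n = c$5 * lor n n" "lor (T c) s = c$4 * lor t s"
      "lor (T c) a = c$2 * u" "lor (T c) b = c$3 * u"
      "lor (T c) t = c$1 * lor s t + c$4 * lor t t"
      using rel by (simp_all add: T_def lor_linear)
    then show ?thesis
      using that assms lor_commute[of s t] by (simp add: vec_eq_iff forall_5)
  qed
  moreover have "T (c - c') = T c - T c'" for c c'
    by (simp add: T_def vec_eq_iff algebra_simps)
  ultimately have "inj T" by (intro injI) (metis eq_iff_diff_eq_0)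
  then have "surj T" by (rule vec.linear_inj_imp_surj[OF lin])
  then obtain c where "w = T c" by blast
  then show thesis using that unfolding T_def by blast
qed

section \<open>Complexification and skew endomorphisms\<close>

lemma bounded_linear_cvec: "bounded_linear cvec"
  unfolding linear_conv_bounded_linear[symmetric]
  by (rule linearI) (simp_all add: cvec_def vec_eq_iff scaleR_conv_of_real[where 'a = complex])

lemma bounded_linear_cnjv: "bounded_linear cnjv"
  unfolding linear_conv_bounded_linear[symmetric]
  by (rule linearI) (simp_all add: cnjv_def vec_eq_iff)

lemma cvec_add: "cvec (v + w) = cvec v + cvec w"
  and cvec_diff: "cvec (v - w) = cvec v - cvec w"
  and cvec_scaleR: "cvec (c *\<^sub>R v) = of_real c *s cvec v"
  and cvec_minus: "cvec (- v) = - cvec v"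
  and cvec_zero [simp]: "cvec 0 = 0"
  and cnjv_cvec [simp]: "cnjv (cvec v) = cvec v"
  by (simp_all add: cvec_def cnjv_def vec_eq_iff scaleR_conv_of_real[where 'a = complex])

lemma cvec_eq_0_iff [simp]: "cvec v = 0 \<longleftrightarrow> v = 0"
  by (simp add: cvec_def vec_eq_iff)

lemma lor_cvec [simp]: "lor (cvec v) (cvec w) = of_real (lor v w)"
  by (simp add: lor_def cvec_def)

lemma lor_cnjv: "lor (cnjv v) (cnjv w) = cnj (lor v w)"
  by (simp add: lor_def cnjv_def)

lemma cnjv_eq_imp_cvec: "cnjv v = v \<Longrightarrow> \<exists>w. v = cvec w"
  by (intro exI[of _ "\<chi> i. Re (v $ i)"])
     (auto simp: cvec_def cnjv_def vec_eq_iff complex_eq_iff)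

lemma wedge_mult: "wedge a b *v w = lor w a *s b - lor w b *s a"
proof -
  have "Vector_Spaces.linear (*s) (*s) (\<lambda>w. lor w a *s b - lor w b *s a)"
    unfolding Vector_Spaces.linear_def module_hom_def module_hom_axioms_def
    by (auto simp: vec_eq_iff algebra_simps lor_linear vec.vector_space_axioms vec.module_axioms)
  then show ?thesis unfolding wedge_def by (rule matrix_works)
qed

lemma wedge_scale_right: "wedge a (c *s b) = mscale c (wedge a b)"
  by (simp add: wedge_def matrix_def mscale_def vec_eq_iff lor_linear algebra_simps)

text \<open>Skewness with respect to \<open>lor\<close>; through \<open>conn_metric\<close> it makes
  the whole family of connections metric.\<close>

lemma wedge_skew_self: "lor (wedge a b *v w) w = 0"
  by (simp add: wedge_mult lor_linear lor_commute[of b w] lor_commute[of a w])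

lemma mscale_mult: "mscale c B *v w = c *s (B *v w)"
  by (simp add: mscale_def matrix_vector_mult_def vec_eq_iff sum_distrib_left algebra_simps)

lemma matrix_eqI: "(\<And>w. A *v w = B *v w) \<Longrightarrow> A = (B :: 'a::comm_ring_1 ^ 'n ^ 'm)"
  by (simp add: matrix_eq)

text \<open>On real vectors the wedge is bilinear over the reals, so the product rule for bounded
  bilinear maps differentiates it.\<close>

definition rwedge :: "real ^ 5 \<Rightarrow> real ^ 5 \<Rightarrow> complex ^ 5 ^ 5" where
  "rwedge a b = wedge (cvec a) (cvec b)"

lemma rwedge_mult: "rwedge a b *v w = lor w (cvec a) *s cvec b - lor w (cvec b) *s cvec a"
  by (simp add: rwedge_def wedge_mult)

lemma scaleR_mult_vec: "(r *\<^sub>R A) *v w = of_real r *s (A *v (w::complex^5))"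
  by (simp add: matrix_vector_mult_def vec_eq_iff sum_distrib_left scaleR_conv_of_real[where 'a = complex] algebra_simps)

lemma minus_mult_vec: "(- A) *v w = - (A *v (w::complex^5))"
  by (simp add: matrix_vector_mult_def vec_eq_iff sum_negf)

lemma mult_vec_minus: "A *v (- w) = - (A *v (w::complex^5))"
  by (simp add: matrix_vector_mult_def vec_eq_iff sum_negf)

lemma bounded_bilinear_rwedge: "bounded_bilinear rwedge"
  unfolding bilinear_conv_bounded_bilinear[symmetric] bilinear_def
  by (auto intro!: linearI matrix_eqI simp: rwedge_mult matrix_vector_mult_add_rdistrib
      scaleR_mult_vec cvec_add cvec_scaleR lor_linear vec_eq_iff algebra_simps)

interpretation rwedge: bounded_bilinear rwedge
  by (rule bounded_bilinear_rwedge)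

lemma rwedge_same [simp]: "rwedge a a = 0"
  by (rule matrix_eqI) (simp add: rwedge_mult)

lemma rwedge_commute: "rwedge a b = - rwedge b a"
  by (rule matrix_eqI) (simp add: rwedge_mult minus_mult_vec)

lemma mscale_of_real: "mscale (of_real r) B = r *\<^sub>R B"
  by (simp add: mscale_def vec_eq_iff scaleR_conv_of_real[where 'a = complex])

lemma rwedge_real: "rwedge a b $ i $ j \<in> \<real>"
proof -
  have "cnj (lor v w) = lor (cnjv v) (cnjv w)" for v w by (simp add: lor_cnjv)
  moreover have "cnjv (axis j 1) = axis j 1" by (simp add: cnjv_def axis_def vec_eq_iff)
  ultimately show ?thesis
    by (simp add: Reals_cnj_iff rwedge_def wedge_def matrix_def) (simp add: cvec_def)
qed

text \<open>A skew endomorphism B acts on wedges as a derivation, [B, c \<and> d] = Bc \<and> d + c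
  \<and> Bd; here B is a \<and> b.\<close>

lemma rwedge_bracket:
  "rwedge a b ** rwedge c d - rwedge c d ** rwedge a b
    = rwedge (lor c a *\<^sub>R b - lor c b *\<^sub>R a) d + rwedge c (lor d a *\<^sub>R b - lor d b *\<^sub>R a)"
  by (rule matrix_eqI)
     (simp add: matrix_vector_mult_diff_rdistrib matrix_vector_mult_add_rdistrib
       matrix_vector_mul_assoc[symmetric] rwedge_mult cvec_diff cvec_scaleR lor_linear
       lor_commute[of b c] lor_commute[of b d] lor_commute[of a c] lor_commute[of a d]
       vec_eq_iff algebra_simps)

section \<open>The central sphere congruence as the orthogonal complement of a unit normal\<close>

lemma dir_lor:
  fixes f g :: "complex \<Rightarrow> 'a::{comm_ring_1, real_normed_algebra_1, euclidean_space} ^ 5"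
  assumes "f differentiable (at p)" "g differentiable (at p)"
  shows "dir (\<lambda>y. lor (f y) (g y)) p X = lor (f p) (dir g p X) + lor (dir f p X) (g p)"
  by (rule dir_bounded_bilinear[OF bounded_bilinear_lor assms])

text \<open>The product rule applied to a constant. Most relations among \<open>\<sigma>\<close>,
  \<open>n\<close>, \<open>vinf\<close> and their derivatives come from it.\<close>

lemma lor_dir_swap:
  fixes f g :: "complex \<Rightarrow> real ^ 5"
  assumes D: "open D" "p \<in> D" and fg: "f differentiable (at p)" "g differentiable (at p)"
    and c: "\<And>y. y \<in> D \<Longrightarrow> lor (f y) (g y) = c"
  shows "lor (dir f p X) (g p) = - lor (f p) (dir g p X)"
proof -
  have "dir (\<lambda>y. lor (f y) (g y)) p X = dir (\<lambda>_. c) p X"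
    by (rule dir_cong_open[OF D c])
  then show ?thesis by (simp add: dir_lor[OF fg])
qed

lemma proj_on_complement:
  assumes N: "lor N N = 1"
  shows "proj_on {w. lor w N = 0} w = w - lor w N *s N"
    and "proj_perp {w. lor w N = 0} w = lor w N *s N"
proof -
  show "proj_on {w. lor w N = 0} w = w - lor w N *s N"
    unfolding proj_on_def
  proof (rule the_equality)
    show "w - lor w N *s N \<in> {w. lor w N = 0} \<and>
        (\<forall>y\<in>{w. lor w N = 0}. lor (w - (w - lor w N *s N)) y = 0)"
      using N by (auto simp: lor_linear) (metis lor_commute mult_zero_right)
  next
    fix u assume u: "u \<in> {w. lor w N = 0} \<and> (\<forall>y\<in>{w. lor w N = 0}. lor (w - u) y = 0)"
    \<comment> \<open>For uniqueness, z is split into a multiple of N and a vector of the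
      complement; the difference of two candidates is orthogonal to both, and \<open>lor\<close> is
      non-degenerate.\<close>
    have "lor (w - lor w N *s N - u) z = 0" for z
    proof -
      have "z - lor z N *s N \<in> {w. lor w N = 0}" using N by (simp add: lor_linear)
      then have "lor (w - u) (z - lor z N *s N) = 0" using u by blast
      moreover have "lor u N = 0" using u by simp
      ultimately show ?thesis using N by (simp add: lor_linear lor_commute[of N z] algebra_simps)
    qed
    then have "w - lor w N *s N - u = 0" by (rule lor_nondegenerate)
    then show "u = w - lor w N *s N" by simp
  qed
  then show "proj_perp {w. lor w N = 0} w = lor w N *s N"
    by (simp add: proj_perp_def)
qed

section \<open>Lifts in a conformal coordinate and their unit normals\<close>

definition dir2 :: "(complex \<Rightarrow> 'b::real_normed_vector) \<Rightarrow> complex \<Rightarrow> complex \<Rightarrow> complex \<Rightarrow> 'b" where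
  "dir2 f p X Y = dir (\<lambda>y. dir f y X) p Y"

lemma dir2_symmetric:
  fixes f :: "complex \<Rightarrow> 'b::euclidean_space"
  shows "open D \<Longrightarrow> p \<in> D \<Longrightarrow> smooth_on D f \<Longrightarrow> dir2 f p X Y = dir2 f p Y X"
  unfolding dir2_def by (rule second_dir_symmetric)

lemma dir2_combine:
  fixes f :: "complex \<Rightarrow> 'b::euclidean_space"
  assumes D: "open D" "p \<in> D" and f: "smooth_on D f"
  shows "dir2 f p X Y = (Re X * Re Y) *\<^sub>R dir2 f p 1 1 + (Re X * Im Y + Im X * Re Y) *\<^sub>R dir2 f p 1 \<i>
    + (Im X * Im Y) *\<^sub>R dir2 f p \<i> \<i>"
proof -
  have 1: "dir2 f p Z Y = Re Y *\<^sub>R dir2 f p Z 1 + Im Y *\<^sub>R dir2 f p Z \<i>" for Z Y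
    unfolding dir2_def
    by (rule dir_combine[OF smooth_on_differentiable[OF smooth_on_dir[OF f] D(2)]])
  have "dir2 f p X Y = dir2 f p Y X" by (rule dir2_symmetric[OF D f])
  also have "\<dots> = Re X *\<^sub>R dir2 f p 1 Y + Im X *\<^sub>R dir2 f p \<i> Y"
    unfolding 1[of Y X] dir2_symmetric[OF D f, of Y 1] dir2_symmetric[OF D f, of Y \<i>] ..
  finally show ?thesis
    by (simp add: 1[of _ Y] dir2_symmetric[OF D f, of \<i> 1] algebra_simps)
qed

text \<open>A lift over a holomorphic chart with the chart itself forgotten: the arguments take
  place on an open set of the plane, and charts reappear only in the last section.\<close>

locale conformal_lift =
  fixes D :: "complex set" and \<sigma> :: "complex \<Rightarrow> real ^ 5"
  assumes open_D: "open D"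
    and smooth_lift: "smooth_on D \<sigma>"
    and lift_nonzero: "p \<in> D \<Longrightarrow> \<sigma> p \<noteq> 0"
    and lift_null: "p \<in> D \<Longrightarrow> lor (\<sigma> p) (\<sigma> p) = 0"
    and conformal: "p \<in> D \<Longrightarrow> \<exists>u>0. \<forall>X Y. lor (dir \<sigma> p X) (dir \<sigma> p Y) = u * (X \<bullet> Y)"
begin

lemma conformal_lift_subset: "open E \<Longrightarrow> E \<subseteq> D \<Longrightarrow> conformal_lift E \<sigma>"
  using smooth_on_subset[OF smooth_lift] lift_nonzero lift_null conformal
  by unfold_locales auto

definition factor :: "complex \<Rightarrow> real" where
  "factor p = lor (dir \<sigma> p 1) (dir \<sigma> p 1)"

text \<open>The Laplacian of the flat coordinate metric, which after complexification is four times
  the mixed derivative in \<open>csc\<close>.\<close>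

definition lap :: "complex \<Rightarrow> real ^ 5" where
  "lap p = dir2 \<sigma> p 1 1 + dir2 \<sigma> p \<i> \<i>"

lemma lor_dir_dir: "p \<in> D \<Longrightarrow> lor (dir \<sigma> p X) (dir \<sigma> p Y) = factor p * (X \<bullet> Y)"
  using conformal[of p] by (auto simp: factor_def)

lemma factor_pos: "p \<in> D \<Longrightarrow> 0 < factor p"
  using conformal[of p] by (auto simp: factor_def)

lemma diff_lift: "p \<in> D \<Longrightarrow> \<sigma> differentiable (at p)"
  and diff_dir_lift: "p \<in> D \<Longrightarrow> (\<lambda>y. dir \<sigma> y X) differentiable (at p)"
  using smooth_on_differentiable smooth_lift smooth_on_dir by blast+

lemma smooth_factor: "smooth_on D factor"
  unfolding factor_def
  by (intro smooth_on_bounded_bilinear[OF open_D bounded_bilinear_lor] smooth_on_dir smooth_lift)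

lemma smooth_lap: "smooth_on D lap"
  unfolding lap_def dir2_def by (intro smooth_on_add open_D smooth_on_dir smooth_lift)

lemma lor_dir_lift: "p \<in> D \<Longrightarrow> lor (dir \<sigma> p X) (\<sigma> p) = 0"
  using lor_dir_swap[OF open_D, of p \<sigma> \<sigma> 0 X] diff_lift lift_null
  by (simp add: lor_commute[of "\<sigma> p" "dir \<sigma> p X"])

lemma lor_dir2_lift: "p \<in> D \<Longrightarrow> lor (dir2 \<sigma> p X Y) (\<sigma> p) = - factor p * (X \<bullet> Y)"
  using lor_dir_swap[OF open_D, of p "\<lambda>y. dir \<sigma> y X" \<sigma> 0 Y] diff_lift diff_dir_lift
    lor_dir_lift lor_dir_dir
  by (simp add: dir2_def)

lemma lor_dir2_dir:
  assumes p: "p \<in> D"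
  shows "lor (dir \<sigma> p X) (dir2 \<sigma> p Y Z) + lor (dir2 \<sigma> p X Z) (dir \<sigma> p Y)
    = dir factor p Z * (X \<bullet> Y)"
proof -
  have "dir (\<lambda>y. lor (dir \<sigma> y X) (dir \<sigma> y Y)) p Z = dir (\<lambda>y. factor y * (X \<bullet> Y)) p Z"
    by (rule dir_cong_open[OF open_D p lor_dir_dir])
  also have "\<dots> = dir factor p Z * (X \<bullet> Y)"
    by (rule dir_bounded_linear[OF bounded_linear_mult_left])
       (rule smooth_on_differentiable[OF smooth_factor p])
  finally show ?thesis
    by (simp add: dir_lor[OF diff_dir_lift[OF p] diff_dir_lift[OF p]] dir2_def)
qed

text \<open>These are the Christoffel symbols of the conformal metric, solved from the
  differentiated conformality relations \<open>lor_dir2_dir\<close> and the symmetry of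
  \<open>dir2\<close>.\<close>

lemma lor_dir2_dir_values:
  assumes p: "p \<in> D"
  shows "lor (dir2 \<sigma> p 1 1) (dir \<sigma> p 1) = dir factor p 1 / 2"
    and "lor (dir2 \<sigma> p 1 \<i>) (dir \<sigma> p 1) = dir factor p \<i> / 2"
    and "lor (dir2 \<sigma> p \<i> \<i>) (dir \<sigma> p 1) = - dir factor p 1 / 2"
    and "lor (dir2 \<sigma> p 1 1) (dir \<sigma> p \<i>) = - dir factor p \<i> / 2"
    and "lor (dir2 \<sigma> p 1 \<i>) (dir \<sigma> p \<i>) = dir factor p 1 / 2"
    and "lor (dir2 \<sigma> p \<i> \<i>) (dir \<sigma> p \<i>) = dir factor p \<i> / 2"
proof -
  note rel = lor_dir2_dir[OF p] lor_commute[of "dir \<sigma> p _" "dir2 \<sigma> p _ _"]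
    dir2_symmetric[OF open_D p smooth_lift, of \<i> 1]
  show 1: "lor (dir2 \<sigma> p 1 1) (dir \<sigma> p 1) = dir factor p 1 / 2"
    and 2: "lor (dir2 \<sigma> p 1 \<i>) (dir \<sigma> p 1) = dir factor p \<i> / 2"
    and 3: "lor (dir2 \<sigma> p 1 \<i>) (dir \<sigma> p \<i>) = dir factor p 1 / 2"
    and 4: "lor (dir2 \<sigma> p \<i> \<i>) (dir \<sigma> p \<i>) = dir factor p \<i> / 2"
    using rel(1)[of 1 1 1] rel(1)[of 1 1 \<i>] rel(1)[of \<i> \<i> 1] rel(1)[of \<i> \<i> \<i>]
    by (simp_all add: rel(2,3))
  show "lor (dir2 \<sigma> p \<i> \<i>) (dir \<sigma> p 1) = - dir factor p 1 / 2"
    and "lor (dir2 \<sigma> p 1 1) (dir \<sigma> p \<i>) = - dir factor p \<i> / 2"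
    using rel(1)[of 1 \<i> 1] rel(1)[of 1 \<i> \<i>] 2 3
    by (simp_all add: rel(2,3))
qed

text \<open>In a conformal coordinate the tangential parts of the two pure second derivatives
  cancel. Hence \<open>lap p\<close> can serve as the vector t of
  \<open>orthogonal_frame_decomposition\<close>.\<close>

lemma lap_relations:
  assumes p: "p \<in> D"
  shows "lor (lap p) (\<sigma> p) = - 2 * factor p"
    and "lor (lap p) (dir \<sigma> p 1) = 0" and "lor (lap p) (dir \<sigma> p \<i>) = 0"
  by (simp_all add: lap_def lor_linear lor_dir2_lift[OF p] lor_dir2_dir_values[OF p])

lemma d_z_lift: "p \<in> D \<Longrightarrow>
    d_z (cvec \<circ> \<sigma>) p = (1/2) *s (cvec (dir \<sigma> p 1) - \<i> *s cvec (dir \<sigma> p \<i>))"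
  and d_zbar_lift: "p \<in> D \<Longrightarrow>
    d_zbar (cvec \<circ> \<sigma>) p = (1/2) *s (cvec (dir \<sigma> p 1) + \<i> *s cvec (dir \<sigma> p \<i>))"
  by (simp_all add: d_z_def d_zbar_def o_def dir_bounded_linear[OF bounded_linear_cvec] diff_lift)

lemma d_zbar_d_z_lift:
  assumes p: "p \<in> D"
  shows "d_zbar (d_z (cvec \<circ> \<sigma>)) p = (1/4) *s cvec (lap p)"
proof -
  note bl = bounded_linear_cvec bounded_linear_compose[OF bounded_linear_smult bounded_linear_cvec]
  have "dir (d_z (cvec \<circ> \<sigma>)) p X
      = (1/2) *s (cvec (dir2 \<sigma> p 1 X) - \<i> *s cvec (dir2 \<sigma> p \<i> X))" for X
  proof -
    have "dir (d_z (cvec \<circ> \<sigma>)) p X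
        = dir (\<lambda>y. (1/2) *s (cvec (dir \<sigma> y 1) - \<i> *s cvec (dir \<sigma> y \<i>))) p X"
      by (rule dir_cong_open[OF open_D p d_z_lift])
    also have "\<dots> = (1/2) *s dir (\<lambda>y. cvec (dir \<sigma> y 1) - \<i> *s cvec (dir \<sigma> y \<i>)) p X"
      using differentiable_bounded_linear[OF bl(1) diff_dir_lift[OF p]]
        differentiable_bounded_linear[OF bl(2) diff_dir_lift[OF p]]
      by (intro dir_bounded_linear[OF bounded_linear_smult] differentiable_diff) auto
    also have "dir (\<lambda>y. cvec (dir \<sigma> y 1) - \<i> *s cvec (dir \<sigma> y \<i>)) p X
        = cvec (dir2 \<sigma> p 1 X) - \<i> *s cvec (dir2 \<sigma> p \<i> X)"
      unfolding dir2_def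
      by (subst dir_diff)
         (auto intro!: differentiable_bounded_linear[OF bl(1)] differentiable_bounded_linear[OF bl(2)]
            simp: dir_bounded_linear[OF bl(1)] dir_bounded_linear[OF bl(2)] diff_dir_lift[OF p])
    finally show ?thesis .
  qed
  then show ?thesis
    unfolding d_zbar_def lap_def
    by (simp only: dir2_symmetric[OF open_D p smooth_lift, of \<i> 1])
       (simp add: cvec_add vec_eq_iff algebra_simps)
qed

text \<open>\<open>normal_part x\<close> is \<open>x\<close> minus its orthogonal projection to the span of the lift, its first
  derivatives and its Laplacian.\<close>

definition normal_part :: "real ^ 5 \<Rightarrow> complex \<Rightarrow> real ^ 5" where
  "normal_part x p =
    (let u = inverse (factor p); \<beta> = - (u * lor x (\<sigma> p)) / 2;
         \<alpha> = - (u * (lor x (lap p) - \<beta> * lor (lap p) (lap p))) / 2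
     in x - (u * lor x (dir \<sigma> p 1)) *\<^sub>R dir \<sigma> p 1 - (u * lor x (dir \<sigma> p \<i>)) *\<^sub>R dir \<sigma> p \<i>
          - \<alpha> *\<^sub>R \<sigma> p - \<beta> *\<^sub>R lap p)"

text \<open>Among the subtracted vectors only \<open>lap p\<close> pairs non-trivially with
  \<open>\<sigma> p\<close>, which fixes its coefficient; orthogonality to \<open>lap p\<close> then
  fixes that of \<open>\<sigma> p\<close>, with a correction for
  \<open>lor (lap p) (lap p)\<close>.\<close>

lemma lor_normal_part:
  assumes p: "p \<in> D"
  shows "lor (normal_part x p) (\<sigma> p) = 0"
    and "lor (normal_part x p) (dir \<sigma> p 1) = 0" and "lor (normal_part x p) (dir \<sigma> p \<i>) = 0"
    and "lor (normal_part x p) (lap p) = 0"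
  using factor_pos[OF p]
  by (simp_all add: normal_part_def Let_def lor_linear lor_dir_lift[OF p] lor_dir_dir[OF p]
      lap_relations[OF p] lift_null[OF p] lor_commute[of "dir \<sigma> p _" "lap p"]
      lor_commute[of "\<sigma> p" "dir \<sigma> p _"] lor_commute[of "\<sigma> p" "lap p"] field_simps)

lemma smooth_normal_part: "smooth_on D (normal_part x)"
proof -
  have lor: "smooth_on D (\<lambda>p. lor (f p) (g p))" if "smooth_on D f" "smooth_on D g"
    for f g :: "complex \<Rightarrow> real ^ 5"
    by (rule smooth_on_bounded_bilinear[OF open_D bounded_bilinear_lor that])
  have inv: "smooth_on D (\<lambda>p. inverse (factor p))"
    using factor_pos by (intro smooth_on_inverse open_D smooth_factor) (metis less_irrefl)
  have half: "smooth_on D (\<lambda>p. - (f p) / 2)" if "smooth_on D f" for f :: "complex \<Rightarrow> real"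
    using smooth_on_mult[OF open_D smooth_on_const[of _ "-1/2"] that] by simp
  show ?thesis
    unfolding normal_part_def Let_def
    by (intro smooth_on_diff smooth_on_scaleR smooth_on_mult half lor inv open_D smooth_on_const
        smooth_on_dir smooth_lift smooth_lap)
qed

end

text \<open>The four orthogonality conditions make \<open>n\<close> a real unit section of the
  complement of the central sphere congruence; see \<open>csc_eq\<close>.\<close>

locale conformal_frame = conformal_lift +
  fixes n :: "complex \<Rightarrow> real ^ 5"
  assumes smooth_normal: "smooth_on D n"
    and normal_unit: "p \<in> D \<Longrightarrow> lor (n p) (n p) = 1"
    and normal_lift: "p \<in> D \<Longrightarrow> lor (n p) (\<sigma> p) = 0"
    and normal_dir1: "p \<in> D \<Longrightarrow> lor (n p) (dir \<sigma> p 1) = 0"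
    and normal_diri: "p \<in> D \<Longrightarrow> lor (n p) (dir \<sigma> p \<i>) = 0"
    and normal_lap: "p \<in> D \<Longrightarrow> lor (n p) (lap p) = 0"

text \<open>A non-zero vector orthogonal to the four frame vectors at \<open>p0\<close> is
  space-like and extends to the smooth field \<open>normal_part x\<close>, which is normalised where
  its square is positive.\<close>

lemma (in conformal_lift) exists_frame:
  assumes "p0 \<in> D"
  obtains r n where "0 < r" "ball p0 r \<subseteq> D" "conformal_frame (ball p0 r) \<sigma> n"
proof -
  obtain x where x: "x \<noteq> 0" "lor x (\<sigma> p0) = 0" "lor x (dir \<sigma> p0 1) = 0"
      "lor x (dir \<sigma> p0 \<i>) = 0" "lor x (lap p0) = 0"
    by (rule exists_orthogonal_to_four)
  define g where "g p = lor (normal_part x p) (normal_part x p)" for p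
  have g: "smooth_on D g"
    unfolding g_def
    by (intro smooth_on_bounded_bilinear[OF open_D bounded_bilinear_lor] smooth_normal_part)
  have "normal_part x p0 = x" using x by (simp add: normal_part_def)
  \<comment> \<open>Being orthogonal to \<open>\<sigma> p0\<close>, a null x would be a multiple of
    it, but \<open>\<sigma> p0\<close> is not orthogonal to \<open>lap p0\<close>.\<close>
  moreover have "lor x x \<noteq> 0"
  proof
    assume "lor x x = 0"
    then obtain c where "x = c *\<^sub>R \<sigma> p0"
      using lor_orthogonal_null(2)[of "\<sigma> p0" x] lift_null lift_nonzero assms x by blast
    with x show False
      using lap_relations(1)[OF assms] factor_pos[OF assms]
      by (auto simp: lor_linear lor_commute[of "\<sigma> p0" "lap p0"])
  qed
  ultimately have "0 < g p0"
    using lor_orthogonal_null(1)[of "\<sigma> p0" x] lift_null lift_nonzero assms x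
    by (force simp: g_def)
  then have "open {p \<in> D. g p \<in> {0<..}}" "p0 \<in> {p \<in> D. g p \<in> {0<..}}"
    using continuous_open_preimage[OF smooth_on_continuous_on[OF g] open_D, of "{0<..}"] assms
    by (auto simp: vimage_def Collect_conj_eq[symmetric] Int_def)
  then obtain r where r: "0 < r" "ball p0 r \<subseteq> {p \<in> D. g p \<in> {0<..}}" by (meson openE)
  then have sub: "ball p0 r \<subseteq> D" by auto
  interpret B: conformal_lift "ball p0 r" \<sigma> by (rule conformal_lift_subset[OF open_ball sub])
  define n where "n p = (1 / sqrt (g p)) *\<^sub>R normal_part x p" for p
  have "conformal_frame (ball p0 r) \<sigma> n"
  proof unfold_locales
    show "smooth_on (ball p0 r) n"
      unfolding n_def using r sub
      by (intro smooth_on_scaleR smooth_on_inverse_sqrt smooth_on_subset[OF g]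
          smooth_on_subset[OF smooth_normal_part] open_ball) auto
  next
    fix p assume p: "p \<in> ball p0 r"
    then have "0 < g p" "p \<in> D" using r by auto
    then show "lor (n p) (n p) = 1"
      by (simp add: n_def lor_linear g_def[symmetric])
    show "lor (n p) (\<sigma> p) = 0" "lor (n p) (dir \<sigma> p 1) = 0" "lor (n p) (dir \<sigma> p \<i>) = 0"
      using lor_normal_part[OF \<open>p \<in> D\<close>] by (simp_all add: n_def lor_linear)
    show "lor (n p) (B.lap p) = 0"
      using lor_normal_part[OF \<open>p \<in> D\<close>] by (simp add: n_def lor_linear)
  qed
  with r sub that show thesis by blast
qed

context conformal_frame
begin

lemma diff_normal: "p \<in> D \<Longrightarrow> n differentiable (at p)"
  and diff_dir_normal: "p \<in> D \<Longrightarrow> (\<lambda>y. dir n y X) differentiable (at p)"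
  using smooth_on_differentiable smooth_normal smooth_on_dir by blast+

lemma normal_dir: "p \<in> D \<Longrightarrow> lor (n p) (dir \<sigma> p X) = 0"
  by (subst dir_combine[OF diff_lift]) (simp_all add: lor_linear normal_dir1 normal_diri)

lemma dir_normal_normal: "p \<in> D \<Longrightarrow> lor (dir n p X) (n p) = 0"
  using lor_dir_swap[OF open_D, of p n n 1 X] diff_normal normal_unit
  by (simp add: lor_commute[of "n p" "dir n p X"])

lemma dir_normal_lift: "p \<in> D \<Longrightarrow> lor (dir n p X) (\<sigma> p) = 0"
  using lor_dir_swap[OF open_D, of p n \<sigma> 0 X] diff_normal diff_lift normal_lift normal_dir
  by simp

lemma dir_normal_dir: "p \<in> D \<Longrightarrow> lor (dir n p X) (dir \<sigma> p Y) = - lor (n p) (dir2 \<sigma> p Y X)"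
  using lor_dir_swap[OF open_D, of p n "\<lambda>y. dir \<sigma> y Y" 0 X] diff_normal diff_dir_lift normal_dir
  by (simp add: dir2_def)

text \<open>The vectors spanning \<open>csc\<close> are orthogonal to the normal; conversely, the
  frame decomposition of a vector orthogonal to the normal has no normal component.\<close>

lemma csc_eq:
  assumes p: "p \<in> D"
  shows "csc \<sigma> p = {w. lor w (cvec (n p)) = 0}"
proof -
  let ?s = "cvec (\<sigma> p)" and ?a = "cvec (dir \<sigma> p 1)" and ?b = "cvec (dir \<sigma> p \<i>)"
    and ?t = "cvec (lap p)" and ?N = "cvec (n p)"
  let ?z = "(1/2) *s (?a - \<i> *s ?b)" and ?zb = "(1/2) *s (?a + \<i> *s ?b)"
  have csc: "csc \<sigma> p = vec.span {?s, ?z, ?zb, (1/4) *s ?t}"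
    unfolding csc_def Let_def d_z_lift[OF p] d_zbar_lift[OF p] d_zbar_d_z_lift[OF p] o_apply ..
  have orth: "lor (n p) (\<sigma> p) = 0" "lor (n p) (dir \<sigma> p 1) = 0" "lor (n p) (dir \<sigma> p \<i>) = 0"
    "lor (n p) (lap p) = 0" "lor (\<sigma> p) (n p) = 0" "lor (dir \<sigma> p 1) (n p) = 0"
    "lor (dir \<sigma> p \<i>) (n p) = 0" "lor (lap p) (n p) = 0"
    using normal_lift[OF p] normal_dir1[OF p] normal_diri[OF p] normal_lap[OF p]
    by (auto simp: lor_commute)
  show ?thesis
  proof (intro equalityI subsetI)
    fix w assume "w \<in> csc \<sigma> p"
    then have "w \<in> vec.span {?s, ?z, ?zb, (1/4) *s ?t}" by (simp add: csc)
    then show "w \<in> {w. lor w ?N = 0}"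
    proof (induction rule: vec.span_induct)
      case base
      show ?case unfolding vec.subspace_def by (simp add: lor_linear)
    next
      case (step x)
      then show ?case by (auto simp: lor_linear orth)
    qed
  next
    fix w assume w: "w \<in> {w. lor w ?N = 0}"
    obtain c1 c2 c3 c4 c5 where c: "w = c1 *s ?s + c2 *s ?a + c3 *s ?b + c4 *s ?t + c5 *s ?N"
      by (rule orthogonal_frame_decomposition[of ?a "of_real (factor p)" ?b ?t ?s ?N w])
         (use factor_pos[OF p] in \<open>simp_all add: lor_dir_dir[OF p] lap_relations[OF p]
           lift_null[OF p] lor_dir_lift[OF p] orth normal_unit[OF p]\<close>)
    have "c5 = 0"
      using w by (simp add: c lor_linear orth normal_unit[OF p])
    \<comment> \<open>Change of basis from the real coordinate derivatives to \<open>d_z\<close> and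
      \<open>d_zbar\<close>; the factor 4 undoes that of \<open>d_zbar_d_z_lift\<close>.\<close>
    moreover have "w - c5 *s ?N = c1 *s ?s + (c2 + \<i> * c3) *s ?z + (c2 - \<i> * c3) *s ?zb + (4 * c4) *s ((1/4) *s ?t)"
      by (simp add: c vec_eq_iff field_simps)
    ultimately have "w = c1 *s ?s + (c2 + \<i> * c3) *s ?z + (c2 - \<i> * c3) *s ?zb + (4 * c4) *s ((1/4) *s ?t)"
      by simp
    then show "w \<in> csc \<sigma> p"
      unfolding csc by (elim ssubst) (intro vec.span_add vec.span_scale vec.span_base insertI1 insertI2)
  qed
qed

lemma Lambda1_lift: "p \<in> D \<Longrightarrow> cvec (\<sigma> p) \<in> Lambda1 \<sigma> p"
  by (auto simp: Lambda1_def Let_def intro!: vec.span_base)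

lemma Lambda1_scale: "\<xi> \<in> Lambda1 \<sigma> p \<Longrightarrow> c *s \<xi> \<in> Lambda1 \<sigma> p"
  and Lambda1_add: "\<xi> \<in> Lambda1 \<sigma> p \<Longrightarrow> \<eta> \<in> Lambda1 \<sigma> p \<Longrightarrow> \<xi> + \<eta> \<in> Lambda1 \<sigma> p"
  and Lambda1_diff: "\<xi> \<in> Lambda1 \<sigma> p \<Longrightarrow> \<eta> \<in> Lambda1 \<sigma> p \<Longrightarrow> \<xi> - \<eta> \<in> Lambda1 \<sigma> p"
  by (auto simp: Lambda1_def Let_def intro: vec.span_scale vec.span_add vec.span_diff)

lemma Lambda1_dir:
  assumes p: "p \<in> D"
  shows "cvec (dir \<sigma> p X) \<in> Lambda1 \<sigma> p"
proof -
  have "d_z (cvec \<circ> \<sigma>) p \<in> Lambda1 \<sigma> p" "d_zbar (cvec \<circ> \<sigma>) p \<in> Lambda1 \<sigma> p"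
    by (auto simp: Lambda1_def Let_def intro!: vec.span_base)
  \<comment> \<open>This is d\<sigma> written through dz and its conjugate, evaluated at X.\<close>
  then have "X *s d_z (cvec \<circ> \<sigma>) p + cnj X *s d_zbar (cvec \<circ> \<sigma>) p \<in> Lambda1 \<sigma> p"
    by (intro Lambda1_add Lambda1_scale)
  moreover have "X *s d_z (cvec \<circ> \<sigma>) p + cnj X *s d_zbar (cvec \<circ> \<sigma>) p = cvec (dir \<sigma> p X)"
    unfolding dir_combine[OF diff_lift[OF p], of X] d_z_lift[OF p] d_zbar_lift[OF p]
    by (simp add: vec_eq_iff cvec_def complex_eq_iff algebra_simps)
  ultimately show ?thesis by simp
qed

section \<open>The splitting of d in terms of the normal\<close>

lemma lor_normal_self: "p \<in> D \<Longrightarrow> lor (cvec (n p)) (cvec (n p)) = 1"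
  by (simp add: normal_unit)

lemma proj_on_csc: "p \<in> D \<Longrightarrow> proj_on (csc \<sigma> p) w = w - lor w (cvec (n p)) *s cvec (n p)"
  and proj_perp_csc: "p \<in> D \<Longrightarrow> proj_perp (csc \<sigma> p) w = lor w (cvec (n p)) *s cvec (n p)"
  using proj_on_complement[OF lor_normal_self] csc_eq by simp_all

text \<open>The projections discard (f, n) dn from the derivative of the normal part of f and -(f,
  dn) n from that of the other part; the sum is n \<and> dn applied to f.\<close>

lemma covD_eq:
  assumes p: "p \<in> D" and f: "f differentiable (at p)"
  shows "covD \<sigma> X f p = dir f p X - rwedge (n p) (dir n p X) *v f p"
proof -
  let ?N = "\<lambda>y. cvec (n y)"
  have N: "?N differentiable (at p)" "dir ?N p X = cvec (dir n p X)"
    using differentiable_bounded_linear[OF bounded_linear_cvec diff_normal[OF p]]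
      dir_bounded_linear[OF bounded_linear_cvec diff_normal[OF p]] by auto
  let ?c = "\<lambda>y. lor (f y) (?N y)"
  have c: "?c differentiable (at p)"
    by (rule differentiable_bounded_bilinear[OF bounded_bilinear_lor f N(1)])
  have cN: "(\<lambda>y. ?c y *s ?N y) differentiable (at p)"
    by (rule differentiable_bounded_bilinear[OF bounded_bilinear_smult c N(1)])
  have d: "dir (\<lambda>y. ?c y *s ?N y) p X = ?c p *s cvec (dir n p X)
      + (lor (f p) (cvec (dir n p X)) + lor (dir f p X) (?N p)) *s ?N p"
    by (simp add: dir_bounded_bilinear[OF bounded_bilinear_smult c N(1)] dir_lor[OF f N(1)] N(2))
  have "dir (\<lambda>y. proj_on (csc \<sigma> y) (f y)) p X = dir (\<lambda>y. f y - ?c y *s ?N y) p X"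
    by (rule dir_cong_open[OF open_D p]) (simp add: proj_on_csc)
  also have "\<dots> = dir f p X - dir (\<lambda>y. ?c y *s ?N y) p X"
    by (rule dir_diff[OF f cN])
  finally have 1: "dir (\<lambda>y. proj_on (csc \<sigma> y) (f y)) p X
      = dir f p X - dir (\<lambda>y. ?c y *s ?N y) p X" .
  have 2: "dir (\<lambda>y. proj_perp (csc \<sigma> y) (f y)) p X = dir (\<lambda>y. ?c y *s ?N y) p X"
    by (rule dir_cong_open[OF open_D p]) (simp add: proj_perp_csc)
  show ?thesis
    unfolding covD_def 1 2 proj_on_csc[OF p] proj_perp_csc[OF p] rwedge_mult d
    using normal_unit[OF p] dir_normal_normal[OF p, of X]
    by (simp add: lor_linear vec_eq_iff algebra_simps)
qed

lemma formN_eq: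
  assumes p: "p \<in> D"
  shows "formN \<sigma> p X = rwedge (n p) (dir n p X)"
  unfolding formN_def by (simp add: covD_eq[OF p])

lemma covD_end_eq:
  assumes p: "p \<in> D" and B: "B differentiable (at p)"
  shows "covD_end \<sigma> X B p = dir B p X
    - (rwedge (n p) (dir n p X) ** B p - B p ** rwedge (n p) (dir n p X))"
proof -
  let ?W = "rwedge (n p) (dir n p X)"
  have bl: "bounded_linear (\<lambda>B :: complex ^ 5 ^ 5. B *v w)" for w
    unfolding linear_conv_bounded_linear[symmetric]
    by (rule linearI) (simp_all add: matrix_vector_mult_add_rdistrib scaleR_mult_vec
        vec_eq_iff scaleR_conv_of_real[where 'a = complex])
  have "covD \<sigma> X (\<lambda>y. B y *v w) p - B p *v covD \<sigma> X (\<lambda>_. w) p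
      = (dir B p X - (?W ** B p - B p ** ?W)) *v w" for w
    by (simp add: covD_eq[OF p] differentiable_bounded_linear[OF bl B] mult_vec_minus dir_bounded_linear[OF bl B]
        matrix_vector_mult_diff_rdistrib matrix_vector_mul_assoc[symmetric]
        matrix_vector_mult_diff_distrib algebra_simps)
  then show ?thesis unfolding covD_end_def by simp
qed

text \<open>The parenthesised terms are \<open>\<D> a\<close> and \<open>\<D> b\<close>, so this is a Leibniz rule.\<close>

lemma covD_end_rwedge:
  assumes p: "p \<in> D" and a: "a differentiable (at p)" and b: "b differentiable (at p)"
  shows "covD_end \<sigma> X (\<lambda>y. rwedge (a y) (b y)) p =
    rwedge (dir a p X - lor (a p) (n p) *\<^sub>R dir n p X + lor (a p) (dir n p X) *\<^sub>R n p) (b p)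
    + rwedge (a p) (dir b p X - lor (b p) (n p) *\<^sub>R dir n p X + lor (b p) (dir n p X) *\<^sub>R n p)"
  by (simp add: covD_end_eq[OF p differentiable_bounded_bilinear[OF bounded_bilinear_rwedge a b]]
      dir_bounded_bilinear[OF bounded_bilinear_rwedge a b] rwedge_bracket
      rwedge.add_left rwedge.add_right rwedge.diff_left rwedge.diff_right)

text \<open>The normal is parallel for D, so the Leibniz rule \<open>covD_end_rwedge\<close> leaves
  only the derivative of dn composed with J; corrections along n drop out because n \<and> n =
  0.\<close>

lemma ext_covD_star_formN:
  assumes p: "p \<in> D"
  shows "ext_covD \<sigma> (star (formN \<sigma>)) p X Y
    = rwedge (n p) (dir2 n p (\<i> * X) Y - dir2 n p (\<i> * Y) X)"
proof -
  have "covD_end \<sigma> Z (\<lambda>y. star (formN \<sigma>) y Y) p = - rwedge (n p) (dir2 n p (\<i> * Y) Z)" for Z Y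
  proof -
    have d: "(\<lambda>y. rwedge (n y) (- dir n y (\<i> * Y))) differentiable (at p)"
      by (intro differentiable_bounded_bilinear[OF bounded_bilinear_rwedge] diff_normal
          differentiable_minus diff_dir_normal p)
    have eq: "rwedge (n y) (- dir n y (\<i> * Y)) = star (formN \<sigma>) y Y" if "y \<in> D" for y
      by (simp add: star_def formN_eq[OF that] rwedge.minus_right)
    have "covD_end \<sigma> Z (\<lambda>y. star (formN \<sigma>) y Y) p
        = covD_end \<sigma> Z (\<lambda>y. rwedge (n y) (- dir n y (\<i> * Y))) p"
      using covD_end_eq[OF p d] covD_end_eq[OF p differentiable_cong_open[OF open_D p eq d]]
        dir_cong_open[OF open_D p eq] eq[OF p] by simp
    also have "\<dots> = - rwedge (n p) (dir2 n p (\<i> * Y) Z)"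
      using dir_bounded_linear[OF bounded_linear_minus[OF bounded_linear_ident]
          diff_dir_normal[OF p], of "\<i> * Y" Z]
      by (subst covD_end_rwedge[OF p diff_normal[OF p] differentiable_minus[OF diff_dir_normal[OF p]]])
         (simp add: normal_unit[OF p] dir_normal_normal[OF p] lor_linear
            lor_commute[of "n p" "dir n p _"] rwedge.add_right rwedge.diff_right
            rwedge.minus_right rwedge.scaleR_right rwedge.zero_left dir2_def)
    finally show ?thesis .
  qed
  then show ?thesis by (simp add: ext_covD_def rwedge.diff_right)
qed

end

section \<open>From conserved quantities to constant mean curvature\<close>

lemma laurent_one_real: "cnjv (v0 p) = v0 p \<Longrightarrow> cnjv (laurent v v0 1 p) = laurent v v0 1 p"
  by (auto simp: laurent_def cnjv_def vec_eq_iff)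

context conformal_frame
begin

lemma perp_csc_eq:
  assumes p: "p \<in> D" and w: "\<And>y. y \<in> csc \<sigma> p \<Longrightarrow> lor w y = 0"
  shows "w = lor w (cvec (n p)) *s cvec (n p)"
proof -
  let ?N = "cvec (n p)"
  have "lor (w - lor w ?N *s ?N) z = 0" for z
  proof -
    have "z - lor z ?N *s ?N \<in> csc \<sigma> p"
      by (simp add: csc_eq[OF p] lor_linear normal_unit[OF p])
    from w[OF this] show ?thesis
      by (simp add: lor_linear lor_commute[of ?N z] algebra_simps)
  qed
  then show ?thesis using lor_nondegenerate by (metis eq_iff_diff_eq_0)
qed

lemma CMC_in_iff:
  "CMC_in D \<sigma> w \<longleftrightarrow> (\<exists>c. \<forall>p\<in>D. (lor w (n p))\<^sup>2 = c)"
proof -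
  have "(let m = proj_perp (csc \<sigma> p) (cvec w) in lor m m) = of_real ((lor w (n p))\<^sup>2)"
    if "p \<in> D" for p
    using that by (simp add: Let_def proj_perp_csc lor_linear normal_unit power2_eq_square)
  then have "CMC_in D \<sigma> w \<longleftrightarrow> (\<exists>c. \<forall>p\<in>D. complex_of_real ((lor w (n p))\<^sup>2) = c)"
    unfolding CMC_in_def constant_on_def by simp
  also have "\<dots> \<longleftrightarrow> (\<exists>c. \<forall>p\<in>D. (lor w (n p))\<^sup>2 = c)"
    by (metis of_real_eq_iff)
  finally show ?thesis .
qed

text \<open>At parameter 1 the coefficients of q vanish and the two parts of N add up to N, which
  gives back d = D + N.\<close>

lemma conn_one:
  assumes p: "p \<in> D" and f: "f differentiable (at p)"
  shows "conn \<sigma> q 1 X f p = dir f p X"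
  unfolding conn_def covD_eq[OF p f] form10_def form01_def formN_eq[OF p]
  by (simp add: mscale_mult matrix_vector_mult_diff_rdistrib matrix_vector_mult_add_rdistrib
      vec_eq_iff algebra_simps)

text \<open>Apart from the derivative of f, every term of \<open>conn\<close> is a skew endomorphism
  applied to f. Hence (f, f) is constant for a parallel f.\<close>

lemma conn_metric:
  assumes p: "p \<in> D" and f: "f differentiable (at p)"
    and q: "\<And>X w. lor (q p X *v w) w = 0"
  shows "lor (conn \<sigma> q \<zeta> X f p) (f p) = lor (dir f p X) (f p)"
proof -
  have "lor (form10 q p X *v w) w = 0" "lor (form01 q p X *v w) w = 0" for w
    by (simp_all add: form10_def form01_def mscale_mult matrix_vector_mult_diff_rdistrib
        matrix_vector_mult_add_rdistrib lor_linear q)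
  moreover have "lor (rwedge a b *v w) w = 0" for a b w
    by (simp add: rwedge_def wedge_skew_self)
  moreover from this have "lor (form10 (formN \<sigma>) p X *v w) w = 0"
    "lor (form01 (formN \<sigma>) p X *v w) w = 0" for w
    by (simp_all add: form10_def form01_def formN_eq[OF p] mscale_mult
        matrix_vector_mult_diff_rdistrib matrix_vector_mult_add_rdistrib lor_linear)
  ultimately show ?thesis
    by (simp add: conn_def covD_eq[OF p f] lor_linear)
qed

lemma conserved_imp_CMC:
  assumes conn: "connected D" and ne: "p0 \<in> D" "laurent v v0 1 p0 \<noteq> 0"
    and v: "smooth_on D v" "smooth_on D v0"
    and v0: "\<And>p. p \<in> D \<Longrightarrow> v0 p \<in> csc \<sigma> p" "\<And>p. p \<in> D \<Longrightarrow> cnjv (v0 p) = v0 p"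
    and perp: "\<And>p y. p \<in> D \<Longrightarrow> y \<in> csc \<sigma> p \<Longrightarrow> lor (v p) y = 0"
    and flat: "\<And>\<zeta> p X. \<zeta> \<noteq> 0 \<Longrightarrow> p \<in> D \<Longrightarrow> conn \<sigma> q \<zeta> X (laurent v v0 \<zeta>) p = 0"
    and q: "\<And>p X w. p \<in> D \<Longrightarrow> lor (q p X *v w) w = 0"
  shows "\<exists>vinf. vinf \<noteq> 0 \<and> CMC_in D \<sigma> vinf"
proof -
  have "smooth_on D (laurent v v0 \<zeta>)" for \<zeta>
    unfolding laurent_def
    by (intro smooth_on_add smooth_on_bounded_linear[OF _ bounded_linear_smult]
        smooth_on_bounded_linear[OF _ bounded_linear_cnjv] open_D v)
  then have diff: "laurent v v0 \<zeta> differentiable (at p)" if "p \<in> D" for \<zeta> p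
    using that smooth_on_differentiable by blast
  obtain vinf where vinf: "laurent v v0 1 p0 = cvec vinf"
    using cnjv_eq_imp_cvec[OF laurent_one_real[of v0 p0 v]] v0 ne by blast
  have const1: "laurent v v0 1 p = cvec vinf" if "p \<in> D" for p
    unfolding vinf[symmetric]
    using that ne flat[of 1] conn_one[OF _ diff] diff
    by (intro dir_zero_constant[OF open_D conn]) auto
  let ?N = "\<lambda>p. cvec (n p)" and ?f = "\<lambda>p. lor (v p) (cvec (n p))"
  have vN: "v p = ?f p *s ?N p" if "p \<in> D" for p
    by (rule perp_csc_eq[OF that perp[OF that]])
  have cvN: "cnjv (v p) = cnj (?f p) *s ?N p" if "p \<in> D" for p
  proof -
    have "cnjv (v p) = cnjv (?f p *s ?N p)" using vN[OF that] by simp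
    then show ?thesis by (simp add: cnjv_def cvec_def vec_eq_iff)
  qed
  have v0N: "lor (v0 p) (?N p) = 0" if "p \<in> D" for p
    using v0(1)[OF that] csc_eq[OF that] by simp
  let ?g = "\<lambda>\<zeta> p. lor (laurent v v0 \<zeta> p) (laurent v v0 \<zeta> p)"
  \<comment> \<open>As v and its conjugate are multiples of the normal, to which \<open>v0\<close>
    is orthogonal, only the powers -2, 0 and 2 of the parameter occur.\<close>
  have g: "?g \<zeta> p = (inverse \<zeta>)\<^sup>2 * (?f p)\<^sup>2 + (lor (v0 p) (v0 p) + 2 * (?f p * cnj (?f p)))
      + \<zeta>\<^sup>2 * cnj ((?f p)\<^sup>2)" if "p \<in> D" "\<zeta> \<noteq> 0" for p \<zeta>
  proof -
    define F where "F = ?f p"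
    have L: "laurent v v0 \<zeta> p = (inverse \<zeta> * F + \<zeta> * cnj F) *s ?N p + v0 p"
      using vN[OF that(1)] cvN[OF that(1)]
      by (simp add: laurent_def F_def[symmetric] vec_eq_iff algebra_simps)
    have "?g \<zeta> p = (inverse \<zeta> * F + \<zeta> * cnj F)\<^sup>2 + lor (v0 p) (v0 p)"
      using v0N[OF that(1)] lor_commute[of "?N p" "v0 p"] normal_unit[OF that(1)]
      by (simp add: L lor_linear power2_eq_square algebra_simps)
    also have "\<dots> = (inverse \<zeta>)\<^sup>2 * F\<^sup>2 + (lor (v0 p) (v0 p) + 2 * (F * cnj F)) + \<zeta>\<^sup>2 * cnj (F\<^sup>2)"
      using that(2) by (simp add: power2_eq_square field_simps)
    finally show ?thesis by (simp add: F_def)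
  qed
  have gconst: "?g \<zeta> x = ?g \<zeta> y" if "x \<in> D" "y \<in> D" "\<zeta> \<noteq> 0" for x y \<zeta>
  proof (rule dir_zero_constant[OF open_D conn _ _ that(1,2)])
    fix p X assume p: "p \<in> D"
    show "?g \<zeta> differentiable (at p)"
      by (rule differentiable_bounded_bilinear[OF bounded_bilinear_lor diff[OF p] diff[OF p]])
    show "dir (?g \<zeta>) p X = 0"
      using conn_metric[where q = q, OF p diff[OF p] q[OF p], of \<zeta> X \<zeta>] flat[OF that(3) p]
      by (simp add: dir_lor[OF diff[OF p] diff[OF p]] lor_commute)
  qed
  have sq: "(?f x)\<^sup>2 = (?f y)\<^sup>2" if x: "x \<in> D" and y: "y \<in> D" for x y
  proof -
    define a b c where "a = (?f x)\<^sup>2 - (?f y)\<^sup>2" and "b = cnj ((?f x)\<^sup>2) - cnj ((?f y)\<^sup>2)"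
      and "c = (lor (v0 x) (v0 x) + 2 * (?f x * cnj (?f x)))
             - (lor (v0 y) (v0 y) + 2 * (?f y * cnj (?f y)))"
    have eq: "(inverse \<zeta>)\<^sup>2 * a + c + \<zeta>\<^sup>2 * b = 0" if "\<zeta> \<noteq> 0" for \<zeta>
      using gconst[OF x y that] unfolding g[OF x that] g[OF y that] a_def b_def c_def
      by (simp add: algebra_simps)
    \<comment> \<open>The parameters 1, i, 2 have the distinct squares 1, -1, 4, so the three
      equations force all coefficients to vanish.\<close>
    have e1: "a + c + b = 0" and e2: "- a + c - b = 0" and e3: "a / 4 + c + 4 * b = 0"
      using eq[of 1] eq[of \<i>] eq[of 2] by (simp_all add: power2_eq_square)
    \<comment> \<open>Four times the first equation minus the third eliminates b; the first two add
      up to 2 c, which removes c.\<close>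
    have "a = (4/15) * (4 * (a + c + b) - (a / 4 + c + 4 * b)) - (2/5) * (a + c + b + (- a + c - b))"
      by (simp add: algebra_simps)
    then have "a = 0" unfolding e1 e2 e3 by simp
    then show ?thesis by (simp add: a_def)
  qed
  have "(lor vinf (n x))\<^sup>2 = (lor vinf (n y))\<^sup>2" if x: "x \<in> D" and y: "y \<in> D" for x y
  proof -
    \<comment> \<open>With F = \<open>?f p\<close>, the square of F + cnj F is F^2 + cnj (F^2) + 2
      |F^2|. It depends on F^2 alone, which is constant by \<open>sq\<close>.\<close>
    have H: "complex_of_real ((lor vinf (n p))\<^sup>2)
        = (?f p)\<^sup>2 + cnj ((?f p)\<^sup>2) + 2 * of_real (norm ((?f p)\<^sup>2))" if "p \<in> D" for p
    proof -
      have "complex_of_real (lor vinf (n p)) = lor (laurent v v0 1 p) (?N p)"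
        using const1[OF that] by simp
      also have "\<dots> = ?f p + cnj (?f p)"
        using cvN[OF that] v0N[OF that] normal_unit[OF that]
        by (simp add: laurent_def lor_linear)
      finally have "complex_of_real ((lor vinf (n p))\<^sup>2) = (?f p + cnj (?f p))\<^sup>2" by simp
      also have "\<dots> = (?f p)\<^sup>2 + cnj ((?f p)\<^sup>2) + 2 * (?f p * cnj (?f p))"
        by (simp add: power2_eq_square algebra_simps)
      finally show ?thesis
        by (simp only: norm_power complex_norm_square)
    qed
    show ?thesis using H[OF x] H[OF y] sq[OF x y] by (metis of_real_eq_iff)
  qed
  then have "CMC_in D \<sigma> vinf" unfolding CMC_in_iff using ne(1) by metis
  moreover have "vinf \<noteq> 0" using vinf ne by auto
  ultimately show ?thesis by blast
qed

end

section \<open>From constant mean curvature to conserved quantities\<close>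

context conformal_frame
begin

text \<open>Common to both cases of the converse: \<open>\<rho>\<close> is the lift scaled to
  \<open>lor vinf \<rho> = - 1\<close>, or the given lift when n is constant. Asking for this
  scaling only after multiplication by dn, in \<open>vinf_\<rho>\<close>, covers both. The condition
  \<open>closed\<close> is the vanishing of d\<rho> \<and> dn.\<close>

lemma multiplier_and_conserved_quantity:
  fixes \<rho> :: "complex \<Rightarrow> real ^ 5" and k :: "complex \<Rightarrow> real"
  assumes ne: "D \<noteq> {}" and vinf: "vinf \<noteq> 0"
    and \<rho>: "smooth_on D \<rho>" "\<And>p. p \<in> D \<Longrightarrow> \<rho> p = k p *\<^sub>R \<sigma> p"
    and H: "\<And>p. p \<in> D \<Longrightarrow> lor (n p) vinf = H"
    and vinf_\<rho>: "\<And>p X. p \<in> D \<Longrightarrow> lor vinf (\<rho> p) *\<^sub>R dir n p X = - dir n p X"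
    and Lambda1: "\<And>p X. p \<in> D \<Longrightarrow> cvec (dir n p X) \<in> Lambda1 \<sigma> p"
    and lap: "\<And>p. p \<in> D \<Longrightarrow> dir2 n p 1 1 + dir2 n p \<i> \<i>
      = - (lor (dir n p 1) (dir n p 1) + lor (dir n p \<i>) (dir n p \<i>)) *\<^sub>R (n p + H *\<^sub>R \<rho> p)"
    and closed: "\<And>p X Y. p \<in> D \<Longrightarrow> rwedge (dir \<rho> p X) (dir n p Y) = rwedge (dir \<rho> p Y) (dir n p X)"
  defines "q \<equiv> \<lambda>p X. rwedge ((H/2) *\<^sub>R \<rho> p) (dir n p X)"
  shows "multiplier D \<sigma> q"
    and "conserved_quantity D \<sigma> q (\<lambda>p. complex_of_real (H/2) *s cvec (n p)) (\<lambda>p. cvec vinf - complex_of_real H *s cvec (n p))"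
proof -
  define a where "a p = (H/2) *\<^sub>R \<rho> p" for p
  have a: "smooth_on D a"
    unfolding a_def by (intro smooth_on_scaleR open_D smooth_on_const \<rho>)
  note a_diff = smooth_on_differentiable[OF a]
  have q: "q p X = rwedge (a p) (dir n p X)" for p X by (simp add: q_def a_def)
  have an: "lor (a p) (n p) = 0" "lor (a p) (dir n p X) = 0"
    "lor (n p) (a p) = 0" "lor (dir n p X) (a p) = 0" if "p \<in> D" for p X
    using normal_lift[OF that] dir_normal_lift[OF that]
    by (simp_all add: a_def \<rho>(2)[OF that] lor_linear lor_commute[of "\<sigma> p"])
  have nn: "lor (n p) (n p) = 1" "lor (dir n p X) (n p) = 0" "lor (n p) (dir n p X) = 0"
    if "p \<in> D" for p X
    using normal_unit[OF that] dir_normal_normal[OF that] by (simp_all add: lor_commute[of "n p" "dir n p X"])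
  have a_dir: "dir a p X = (H/2) *\<^sub>R dir \<rho> p X" if "p \<in> D" for p X
    unfolding a_def
    by (rule dir_bounded_linear[OF bounded_linear_scaleR_right smooth_on_differentiable[OF \<rho>(1) that]])
  show "multiplier D \<sigma> q"
    unfolding multiplier_def
  proof (intro conjI ballI allI)
    show "real_form D \<sigma> q"
      unfolding real_form_def
    proof (intro conjI allI ballI)
      show "smooth_on D (\<lambda>p. q p X)" for X
        unfolding q
        by (intro smooth_on_bounded_bilinear[OF open_D bounded_bilinear_rwedge] a smooth_on_dir smooth_normal)
    next
      fix p assume p: "p \<in> D"
      show "linear (q p)"
        using linear_compose[OF linear_dir[OF diff_normal[OF p]]
            bounded_linear.linear[OF rwedge.bounded_linear_right[of "a p"]]]
        by (simp add: o_def q[abs_def])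
      fix X
      have "q p X = wedge (cvec (\<sigma> p)) (of_real (H/2 * k p) *s cvec (dir n p X))"
        unfolding wedge_scale_right mscale_of_real rwedge_def[symmetric]
        by (simp add: q a_def \<rho>(2)[OF p] rwedge.scaleR_left)
      then show "\<exists>\<xi>\<in>Lambda1 \<sigma> p. q p X = wedge (cvec (\<sigma> p)) \<xi>"
        using Lambda1_scale[OF Lambda1[OF p]] by blast
      show "q p X $ i $ j \<in> \<real>" for i j
        by (simp add: q rwedge_real)
    qed
  next
    fix p X Y assume p: "p \<in> D"
    \<comment> \<open>As \<open>a\<close> is orthogonal to n and dn, D a = da. In the exterior
      derivative the terms with \<open>a p\<close> are symmetric in X and Y and cancel; the rest
      vanishes by \<open>closed\<close>.\<close>
    have "covD_end \<sigma> X (\<lambda>y. q y Y) p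
        = rwedge (dir a p X) (dir n p Y) + rwedge (a p) (dir2 n p Y X + lor (dir n p Y) (dir n p X) *\<^sub>R n p)"
      for X Y
      unfolding q
      by (simp add: covD_end_rwedge[OF p a_diff[OF p] diff_dir_normal[OF p]] an[OF p] nn[OF p] dir2_def)
    then show "ext_covD \<sigma> q p X Y = 0"
      using closed[OF p, of X Y] dir2_symmetric[OF open_D p smooth_normal, of X Y]
        lor_commute[of "dir n p X" "dir n p Y"]
      by (simp add: ext_covD_def a_dir[OF p] rwedge.scaleR_left)
    \<comment> \<open>\<open>J\<close> is the area form on X and Y, and \<open>e\<close> is |dn|^2.
      Both sides of the second multiplier equation turn out to be -2 J e times n \<and> a.\<close>
    define J where "J = Re X * Im Y - Im X * Re Y"
    define e where "e = lor (dir n p 1) (dir n p 1) + lor (dir n p \<i>) (dir n p \<i>)"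
    have "dir2 n p (\<i> * X) Y - dir2 n p (\<i> * Y) X = J *\<^sub>R (dir2 n p 1 1 + dir2 n p \<i> \<i>)"
      unfolding dir2_combine[OF open_D p smooth_normal, of "\<i> * X"]
        dir2_combine[OF open_D p smooth_normal, of "\<i> * Y"]
      by (simp add: J_def vec_eq_iff algebra_simps)
    then have L: "ext_covD \<sigma> (star (formN \<sigma>)) p X Y = - (2 * J * e) *\<^sub>R rwedge (n p) (a p)"
      unfolding ext_covD_star_formN[OF p] lap[OF p] e_def[symmetric]
      by (simp add: rwedge.add_right rwedge.scaleR_right rwedge.minus_right rwedge.diff_right
          scaleR_add_right a_def)
    have S: "star (formN \<sigma>) p Z = rwedge (n p) (- dir n p (\<i> * Z))" for Z
      by (simp add: star_def formN_eq[OF p] rwedge.minus_right)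
    have "bracket_wedge q (star (formN \<sigma>)) p X Y
        = (lor (dir n p (\<i> * Y)) (dir n p X) - lor (dir n p (\<i> * X)) (dir n p Y)) *\<^sub>R rwedge (n p) (a p)"
      unfolding bracket_wedge_def S q rwedge_bracket
      by (simp add: an[OF p] nn[OF p] lor_linear rwedge.zero_left rwedge.scaleR_right algebra_simps)
    moreover have "lor (dir n p (\<i> * Y)) (dir n p X) - lor (dir n p (\<i> * X)) (dir n p Y) = - (J * e)"
      unfolding dir_combine[OF diff_normal[OF p], of X] dir_combine[OF diff_normal[OF p], of Y]
        dir_combine[OF diff_normal[OF p], of "\<i> * X"] dir_combine[OF diff_normal[OF p], of "\<i> * Y"]
      by (simp add: lor_linear J_def e_def lor_commute[of "dir n p \<i>" "dir n p 1"] algebra_simps)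
    ultimately show "ext_covD \<sigma> (star (formN \<sigma>)) p X Y
        = mscale 2 (bracket_wedge q (star (formN \<sigma>)) p X Y)"
      using L mscale_of_real[of 2] by simp
  qed
  have vinf_dir: "lor vinf (dir n p X) = 0" if "p \<in> D" for p X
    using lor_dir_swap[OF open_D that diff_normal[OF that] differentiable_const H]
    by (simp add: lor_commute)
  have vinf_n: "lor vinf (n p) = H" if "p \<in> D" for p
    using H[OF that] by (simp add: lor_commute)
  show "conserved_quantity D \<sigma> q (\<lambda>p. complex_of_real (H/2) *s cvec (n p)) (\<lambda>p. cvec vinf - complex_of_real H *s cvec (n p))"
    unfolding conserved_quantity_def
  proof (intro conjI ballI allI impI)
    show "smooth_on D (\<lambda>p. complex_of_real (H/2) *s cvec (n p))"
      by (intro smooth_on_bounded_linear[OF open_D bounded_linear_smult]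
          smooth_on_bounded_linear[OF open_D bounded_linear_cvec] smooth_normal)
    show "smooth_on D (\<lambda>p. cvec vinf - complex_of_real H *s cvec (n p))"
      by (intro smooth_on_diff open_D smooth_on_const smooth_on_bounded_linear[OF open_D bounded_linear_smult]
          smooth_on_bounded_linear[OF open_D bounded_linear_cvec] smooth_normal)
    show "\<exists>p\<in>D. laurent (\<lambda>p. complex_of_real (H/2) *s cvec (n p)) (\<lambda>p. cvec vinf - complex_of_real H *s cvec (n p)) 1 p \<noteq> 0"
    proof -
      obtain p where "p \<in> D" using ne by blast
      moreover have "laurent (\<lambda>p. complex_of_real (H/2) *s cvec (n p)) (\<lambda>p. cvec vinf - complex_of_real H *s cvec (n p)) 1 p = cvec vinf"
        by (simp add: laurent_def cnjv_def cvec_def vec_eq_iff)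
      ultimately show ?thesis using vinf by (metis cvec_eq_0_iff)
    qed
  next
    fix p assume p: "p \<in> D"
    show "cvec vinf - complex_of_real H *s cvec (n p) \<in> csc \<sigma> p"
      by (simp add: csc_eq[OF p] lor_linear vinf_n[OF p] nn[OF p])
    show "cnjv (cvec vinf - complex_of_real H *s cvec (n p)) = cvec vinf - complex_of_real H *s cvec (n p)"
      by (simp add: cnjv_def cvec_def vec_eq_iff)
    show "lor (complex_of_real (H/2) *s cvec (n p)) y = 0" if "y \<in> csc \<sigma> p" for y
      using that by (simp add: csc_eq[OF p] lor_linear lor_commute[of "cvec (n p)" y])
  next
    fix \<zeta> p X assume \<zeta>: "\<zeta> \<noteq> (0::complex)" and p: "p \<in> D"
    \<comment> \<open>The Laurent polynomial equals vinf + (c - H) n, and \<open>c\<close> is its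
      product with n.\<close>
    define c where "c = complex_of_real (H/2) * (\<zeta> + inverse \<zeta>)"
    define f where "f = (\<lambda>y. cvec vinf + (c - H) *s cvec (n y))"
    have L: "laurent (\<lambda>p. complex_of_real (H/2) *s cvec (n p)) (\<lambda>p. cvec vinf - complex_of_real H *s cvec (n p)) \<zeta> = f"
      by (auto simp: laurent_def f_def c_def cnjv_def cvec_def vec_eq_iff fun_eq_iff field_simps)
    note bl = bounded_linear_compose[OF bounded_linear_smult bounded_linear_cvec]
    have f: "f differentiable (at p)" "dir f p X = (c - H) *s cvec (dir n p X)"
      unfolding f_def
      by (intro differentiable_add differentiable_const differentiable_bounded_linear[OF bl] diff_normal p)
        (simp only: dir_add[OF differentiable_const differentiable_bounded_linear[OF bl diff_normal[OF p]]]
          dir_const dir_bounded_linear[OF bl diff_normal[OF p]] add_0)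
    \<comment> \<open>Since dn is orthogonal to vinf and n, both N and q map the polynomial to
      multiples of dn, so parallelism reduces to two scalar identities in \<zeta>.\<close>
    have N: "rwedge (n p) (dir n p Z) *v f p = c *s cvec (dir n p Z)" for Z
      by (simp add: f_def rwedge_mult lor_linear vinf_n[OF p] vinf_dir[OF p] nn[OF p])
    have Q: "q p Z *v f p = (- H/2) *s cvec (dir n p Z)" for Z
    proof -
      have "q p Z *v f p = of_real (lor vinf (a p)) *s cvec (dir n p Z)"
        by (simp add: q f_def rwedge_mult lor_linear vinf_dir[OF p] nn[OF p] an[OF p])
      also have "\<dots> = complex_of_real (H/2) *s cvec (lor vinf (\<rho> p) *\<^sub>R dir n p Z)"
        by (simp add: a_def lor_linear cvec_scaleR)
      finally show ?thesis by (simp add: vinf_\<rho>[OF p] cvec_minus vec_eq_iff)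
    qed
    \<comment> \<open>Folding the inverse into \<open>z\<close> makes the comparison of coefficients
      polynomial.\<close>
    define z where "z = inverse \<zeta>"
    have "conn \<sigma> q \<zeta> X f p = (c - H - c
        + inverse \<zeta> * c / 2 + \<zeta> * c / 2 - ((inverse \<zeta>)\<^sup>2 - 1) * H / 4 - (\<zeta>\<^sup>2 - 1) * H / 4) *s cvec (dir n p X)
       + (\<i> * (- inverse \<zeta> * c / 2 + \<zeta> * c / 2 + ((inverse \<zeta>)\<^sup>2 - 1) * H / 4 - (\<zeta>\<^sup>2 - 1) * H / 4)) *s
         cvec (dir n p (\<i> * X))"
      unfolding conn_def covD_eq[OF p f(1)] form10_def form01_def formN_eq[OF p] mscale_mult
        matrix_vector_mult_diff_rdistrib matrix_vector_mult_add_rdistrib N Q f(2) z_def[symmetric]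
      by (simp add: vec_eq_iff field_simps)
    also have "\<dots> = 0"
    proof -
      have 1: "c - H - c + inverse \<zeta> * c / 2 + \<zeta> * c / 2 - ((inverse \<zeta>)\<^sup>2 - 1) * H / 4 - (\<zeta>\<^sup>2 - 1) * H / 4 = 0"
        using \<zeta> by (simp add: c_def power2_eq_square field_simps)
      have 2: "- inverse \<zeta> * c / 2 + \<zeta> * c / 2 + ((inverse \<zeta>)\<^sup>2 - 1) * H / 4 - (\<zeta>\<^sup>2 - 1) * H / 4 = 0"
        using \<zeta> by (simp add: c_def power2_eq_square field_simps)
      show ?thesis unfolding 1 2 by simp
    qed
    finally show "conn \<sigma> q \<zeta> X
        (laurent (\<lambda>p. complex_of_real (H/2) *s cvec (n p)) (\<lambda>p. cvec vinf - complex_of_real H *s cvec (n p)) \<zeta>) p = 0"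
      unfolding L .
  qed
qed

end

section \<open>Rescaled lifts and their geometry in a space-form\<close>

lemma (in conformal_frame) conformal_frame_subset:
  assumes "open E" "E \<subseteq> D"
  shows "conformal_frame E \<sigma> n"
proof -
  interpret E: conformal_lift E \<sigma> by (rule conformal_lift_subset[OF assms])
  show ?thesis
    using assms(2) smooth_on_subset[OF smooth_normal] normal_unit normal_lift normal_dir1 normal_diri
      normal_lap
    by unfold_locales auto
qed

lemma (in conformal_frame) dir_rescale:
  assumes k: "smooth_on D k" and p: "p \<in> D"
  shows "dir (\<lambda>p. k p *\<^sub>R \<sigma> p) p X = k p *\<^sub>R dir \<sigma> p X + dir k p X *\<^sub>R \<sigma> p"
  by (rule dir_bounded_bilinear[OF bounded_bilinear_scaleR smooth_on_differentiable[OF k p] diff_lift[OF p]])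

text \<open>The central sphere congruence depends on the line bundle alone, so n is kept. For the
  Laplacian, the product of n with a second derivative of k\<sigma> is -(dn, d(k\<sigma>)), where dk
  disappears because dn is orthogonal to \<sigma>.\<close>

lemma (in conformal_frame) conformal_frame_rescale:
  assumes k: "smooth_on D k" and nz: "\<And>p. p \<in> D \<Longrightarrow> k p \<noteq> 0"
  shows "conformal_frame D (\<lambda>p. k p *\<^sub>R \<sigma> p) n"
proof -
  let ?\<rho> = "\<lambda>p. k p *\<^sub>R \<sigma> p"
  have \<rho>: "smooth_on D ?\<rho>" by (intro smooth_on_scaleR open_D k smooth_lift)
  note d = dir_rescale[OF k]
  have n\<rho>: "lor (n p) (dir ?\<rho> p X) = 0" if "p \<in> D" for p X
    using that by (simp add: d lor_linear normal_dir normal_lift)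
  interpret R: conformal_lift D ?\<rho>
  proof
    show "open D" by (rule open_D)
    show "smooth_on D ?\<rho>" by (rule \<rho>)
    fix p assume p: "p \<in> D"
    show "?\<rho> p \<noteq> 0" using nz[OF p] lift_nonzero[OF p] by simp
    show "lor (?\<rho> p) (?\<rho> p) = 0" using lift_null[OF p] by (simp add: lor_linear)
    have "0 < k p * k p * factor p"
      using nz[OF p] not_real_square_gt_zero[of "k p"] factor_pos[OF p]
      by (metis mult_pos_pos)
    then show "\<exists>u>0. \<forall>X Y. lor (dir ?\<rho> p X) (dir ?\<rho> p Y) = u * (X \<bullet> Y)"
      by (intro exI[of _ "k p * k p * factor p"])
         (simp add: d[OF p] lor_linear lor_dir_dir[OF p] lor_dir_lift[OF p] lift_null[OF p]
            lor_commute[of "\<sigma> p" "dir \<sigma> p _"])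
  qed
  have "lor (n p) (dir2 ?\<rho> p X X) = k p * lor (n p) (dir2 \<sigma> p X X)" if p: "p \<in> D" for p X
  proof -
    have "lor (n p) (dir2 ?\<rho> p X X) = - lor (dir n p X) (dir ?\<rho> p X)"
      using lor_dir_swap[OF open_D p diff_normal[OF p] R.diff_dir_lift[OF p] n\<rho>]
      by (simp add: dir2_def)
    then show ?thesis
      by (simp add: d[OF p] lor_linear dir_normal_lift[OF p] dir_normal_dir[OF p])
  qed
  then have "lor (n p) (R.lap p) = k p * lor (n p) (lap p)" if "p \<in> D" for p
    using that by (simp add: R.lap_def lap_def lor_linear algebra_simps)
  then show ?thesis
    using smooth_normal normal_unit normal_lift n\<rho> normal_lap
    by unfold_locales (simp_all add: lor_linear)
qed

text \<open>Rescaling the lift to satisfy \<open>lor vinf \<sigma> = - 1\<close> maps the surface to the space-form.\<close>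

locale cmc_frame = conformal_frame +
  fixes vinf :: "real ^ 5" and H :: real
  assumes vinf_lift: "p \<in> D \<Longrightarrow> lor vinf (\<sigma> p) = - 1"
    and mean_curvature: "p \<in> D \<Longrightarrow> lor vinf (n p) = H"
begin

lemma vinf_dir_lift: "p \<in> D \<Longrightarrow> lor vinf (dir \<sigma> p X) = 0"
  using lor_dir_swap[OF open_D _ differentiable_const diff_lift vinf_lift] by simp

lemma vinf_dir_normal: "p \<in> D \<Longrightarrow> lor vinf (dir n p X) = 0"
  using lor_dir_swap[OF open_D _ differentiable_const diff_normal mean_curvature] by simp

lemma vinf_dir2_normal: "p \<in> D \<Longrightarrow> lor vinf (dir2 n p X Y) = 0"
  using lor_dir_swap[OF open_D _ differentiable_const diff_dir_normal vinf_dir_normal]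
  by (simp add: dir2_def)

text \<open>\<open>vinf - H *\<^sub>R n p\<close> has product -1 with \<sigma> and is orthogonal to
  n and to the tangent vectors, so it replaces the Laplacian in the frame.\<close>

lemma orthogonal_imp_zero:
  assumes p: "p \<in> D" and w: "lor w (\<sigma> p) = 0" "lor w (dir \<sigma> p 1) = 0" "lor w (dir \<sigma> p \<i>) = 0"
    "lor w vinf = 0" "lor w (n p) = 0"
  shows "w = 0"
proof (rule lor_nondegenerate)
  fix z
  have n: "lor (n p) (n p) = 1" "lor (n p) (\<sigma> p) = 0" "lor (n p) (dir \<sigma> p 1) = 0"
    "lor (n p) (dir \<sigma> p \<i>) = 0" "lor (n p) vinf = H"
    using normal_unit[OF p] normal_lift[OF p] normal_dir[OF p] mean_curvature[OF p]
    by (simp_all add: lor_commute[of "n p" vinf])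
  obtain c1 c2 c3 c4 c5 where "z = c1 *s \<sigma> p + c2 *s dir \<sigma> p 1 + c3 *s dir \<sigma> p \<i>
      + c4 *s (vinf - H *\<^sub>R n p) + c5 *s n p"
    by (rule orthogonal_frame_decomposition[of "dir \<sigma> p 1" "factor p" "dir \<sigma> p \<i>"
          "vinf - H *\<^sub>R n p" "\<sigma> p" "n p" z])
       (use factor_pos[OF p] in \<open>simp_all add: n lor_linear lor_dir_dir[OF p] lor_dir_lift[OF p]
          lift_null[OF p] vinf_lift[OF p] vinf_dir_lift[OF p]\<close>)
  then show "lor w z = 0" using w by (simp add: lor_linear)
qed

text \<open>The second fundamental form is symmetric since second derivatives of the lift commute,
  and trace-free since n is orthogonal to \<open>lap\<close>.\<close>

lemma dir_normal_symmetric: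
  assumes p: "p \<in> D"
  shows "lor (dir n p \<i>) (dir \<sigma> p 1) = lor (dir n p 1) (dir \<sigma> p \<i>)"
    and "lor (dir n p \<i>) (dir \<sigma> p \<i>) = - lor (dir n p 1) (dir \<sigma> p 1)"
  using dir2_symmetric[OF open_D p smooth_lift, of \<i> 1] normal_lap[OF p]
  by (simp_all add: dir_normal_dir[OF p] lap_def lor_linear)

text \<open>Together with \<beta>, the entries of the trace-free symmetric matrix of dn relative to
  d\<sigma>.\<close>

definition \<alpha> :: "complex \<Rightarrow> real" where "\<alpha> p = lor (dir n p 1) (dir \<sigma> p 1) / factor p"

definition \<beta> :: "complex \<Rightarrow> real" where "\<beta> p = lor (dir n p 1) (dir \<sigma> p \<i>) / factor p"

text \<open>Constant mean curvature enters through \<open>vinf_dir_normal\<close>: orthogonality to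
  vinf excludes a component of dn along \<sigma>.\<close>

lemma dir_normal_eq:
  assumes p: "p \<in> D"
  shows "dir n p 1 = \<alpha> p *\<^sub>R dir \<sigma> p 1 + \<beta> p *\<^sub>R dir \<sigma> p \<i>"
    and "dir n p \<i> = \<beta> p *\<^sub>R dir \<sigma> p 1 - \<alpha> p *\<^sub>R dir \<sigma> p \<i>"
proof -
  have "lor (dir \<sigma> p X) (n p) = 0" "lor (dir \<sigma> p X) vinf = 0" "lor (dir n p X) vinf = 0" for X
    using normal_dir[OF p] vinf_dir_lift[OF p] vinf_dir_normal[OF p] by (simp_all add: lor_commute)
  note rel = this lor_linear lor_dir_dir[OF p] lor_dir_lift[OF p] dir_normal_lift[OF p]
    dir_normal_normal[OF p] dir_normal_symmetric[OF p]
  have "dir n p 1 - (\<alpha> p *\<^sub>R dir \<sigma> p 1 + \<beta> p *\<^sub>R dir \<sigma> p \<i>) = 0"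
    using factor_pos[OF p] by (intro orthogonal_imp_zero[OF p]) (simp_all add: rel \<alpha>_def \<beta>_def)
  then show "dir n p 1 = \<alpha> p *\<^sub>R dir \<sigma> p 1 + \<beta> p *\<^sub>R dir \<sigma> p \<i>" by simp
  have "dir n p \<i> - (\<beta> p *\<^sub>R dir \<sigma> p 1 - \<alpha> p *\<^sub>R dir \<sigma> p \<i>) = 0"
    using factor_pos[OF p] by (intro orthogonal_imp_zero[OF p]) (simp_all add: rel \<alpha>_def \<beta>_def)
  then show "dir n p \<i> = \<beta> p *\<^sub>R dir \<sigma> p 1 - \<alpha> p *\<^sub>R dir \<sigma> p \<i>" by simp
qed

text \<open>Trace-freeness makes the two contributions of \<alpha> to d\<sigma> \<and> dn on the
  pair 1, i cancel. This gives the closedness of q.\<close>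

lemma rwedge_dir_normal:
  assumes p: "p \<in> D"
  shows "rwedge (dir \<sigma> p X) (dir n p Y) = rwedge (dir \<sigma> p Y) (dir n p X)"
  unfolding dir_combine[OF diff_lift[OF p], of X] dir_combine[OF diff_lift[OF p], of Y]
    dir_combine[OF diff_normal[OF p], of X] dir_combine[OF diff_normal[OF p], of Y] dir_normal_eq[OF p]
  by (simp add: rwedge.add_left rwedge.add_right rwedge.diff_right rwedge.scaleR_left
      rwedge.scaleR_right rwedge_commute[of "dir \<sigma> p \<i>" "dir \<sigma> p 1"] vec_eq_iff
      algebra_simps)

lemma lor_dir2_normal_dir:
  assumes p: "p \<in> D"
  shows "lor (dir2 n p 1 X) (dir \<sigma> p 1) + lor (dir n p 1) (dir2 \<sigma> p 1 X)
      = - lor (dir2 n p \<i> X) (dir \<sigma> p \<i>) - lor (dir n p \<i>) (dir2 \<sigma> p \<i> X)"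
    and "lor (dir2 n p 1 X) (dir \<sigma> p \<i>) + lor (dir n p 1) (dir2 \<sigma> p \<i> X)
      = lor (dir2 n p \<i> X) (dir \<sigma> p 1) + lor (dir n p \<i>) (dir2 \<sigma> p 1 X)"
proof -
  have d: "dir (\<lambda>y. lor (dir n y Y) (dir \<sigma> y Z)) p X
      = lor (dir n p Y) (dir2 \<sigma> p Z X) + lor (dir2 n p Y X) (dir \<sigma> p Z)" for Y Z
    by (simp add: dir_lor[OF diff_dir_normal[OF p] diff_dir_lift[OF p]] dir2_def)
  have "dir (\<lambda>y. lor (dir n y \<i>) (dir \<sigma> y \<i>)) p X = dir (\<lambda>y. - lor (dir n y 1) (dir \<sigma> y 1)) p X"
    by (rule dir_cong_open[OF open_D p dir_normal_symmetric(2)])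
  also have "\<dots> = - dir (\<lambda>y. lor (dir n y 1) (dir \<sigma> y 1)) p X"
    by (rule dir_bounded_linear[OF bounded_linear_minus[OF bounded_linear_ident]
          differentiable_bounded_bilinear[OF bounded_bilinear_lor diff_dir_normal[OF p] diff_dir_lift[OF p]]])
  finally show "lor (dir2 n p 1 X) (dir \<sigma> p 1) + lor (dir n p 1) (dir2 \<sigma> p 1 X)
      = - lor (dir2 n p \<i> X) (dir \<sigma> p \<i>) - lor (dir n p \<i>) (dir2 \<sigma> p \<i> X)"
    unfolding d by simp
  have "dir (\<lambda>y. lor (dir n y \<i>) (dir \<sigma> y 1)) p X = dir (\<lambda>y. lor (dir n y 1) (dir \<sigma> y \<i>)) p X"
    by (rule dir_cong_open[OF open_D p dir_normal_symmetric(1)])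
  then show "lor (dir2 n p 1 X) (dir \<sigma> p \<i>) + lor (dir n p 1) (dir2 \<sigma> p \<i> X)
      = lor (dir2 n p \<i> X) (dir \<sigma> p 1) + lor (dir n p \<i>) (dir2 \<sigma> p 1 X)"
    unfolding d by simp
qed

text \<open>A consequence of the Codazzi equation: the derivatives of symmetry and trace-freeness
  express the tangential part of the Laplacian of n through products of dn with second derivatives
  of \<sigma>, which cancel by \<open>lor_dir2_dir_values\<close>.\<close>

lemma lap_normal_dir:
  assumes p: "p \<in> D"
  shows "lor (dir2 n p 1 1 + dir2 n p \<i> \<i>) (dir \<sigma> p 1) = 0"
    and "lor (dir2 n p 1 1 + dir2 n p \<i> \<i>) (dir \<sigma> p \<i>) = 0"
proof -
  note sym = dir2_symmetric[OF open_D p smooth_lift, of \<i> 1] dir2_symmetric[OF open_D p smooth_normal, of \<i> 1]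
  have val: "lor (dir \<sigma> p X) (dir2 \<sigma> p Y Z) = lor (dir2 \<sigma> p Y Z) (dir \<sigma> p X)" for X Y Z
    by (rule lor_commute)
  note vals = dir_normal_eq[OF p] lor_linear val lor_dir2_dir_values[OF p] sym
  have "lor (dir2 n p 1 1 + dir2 n p \<i> \<i>) (dir \<sigma> p 1)
      = lor (dir n p 1) (dir2 \<sigma> p \<i> \<i>) - lor (dir n p 1) (dir2 \<sigma> p 1 1) - 2 * lor (dir n p \<i>) (dir2 \<sigma> p 1 \<i>)"
    using lor_dir2_normal_dir(1)[OF p, of 1] lor_dir2_normal_dir(2)[OF p, of \<i>]
    by (simp add: lor_linear sym)
  also have "\<dots> = 0" by (simp add: vals)
  finally show "lor (dir2 n p 1 1 + dir2 n p \<i> \<i>) (dir \<sigma> p 1) = 0" .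
  have "lor (dir2 n p 1 1 + dir2 n p \<i> \<i>) (dir \<sigma> p \<i>)
      = lor (dir n p \<i>) (dir2 \<sigma> p 1 1) - lor (dir n p \<i>) (dir2 \<sigma> p \<i> \<i>) - 2 * lor (dir n p 1) (dir2 \<sigma> p 1 \<i>)"
    using lor_dir2_normal_dir(1)[OF p, of \<i>] lor_dir2_normal_dir(2)[OF p, of 1]
    by (simp add: lor_linear sym)
  also have "\<dots> = 0" by (simp add: vals)
  finally show "lor (dir2 n p 1 1 + dir2 n p \<i> \<i>) (dir \<sigma> p \<i>) = 0" .
qed

text \<open>Both sides have the same products with the frame of \<open>orthogonal_imp_zero\<close>.
  The summand H \<sigma> makes n + H \<sigma> orthogonal to vinf, as the Laplacian of n is.\<close>

lemma lap_normal:
  assumes p: "p \<in> D"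
  shows "dir2 n p 1 1 + dir2 n p \<i> \<i>
    = - (lor (dir n p 1) (dir n p 1) + lor (dir n p \<i>) (dir n p \<i>)) *\<^sub>R (n p + H *\<^sub>R \<sigma> p)"
proof -
  define e where "e = lor (dir n p 1) (dir n p 1) + lor (dir n p \<i>) (dir n p \<i>)"
  let ?L = "dir2 n p 1 1 + dir2 n p \<i> \<i>"
  have 1: "lor (dir2 n p X X) (\<sigma> p) = - lor (dir n p X) (dir \<sigma> p X)" for X
    using lor_dir_swap[OF open_D p diff_dir_normal[OF p] diff_lift[OF p] dir_normal_lift]
    by (simp add: dir2_def)
  have 2: "lor (dir2 n p X X) (n p) = - lor (dir n p X) (dir n p X)" for X
    using lor_dir_swap[OF open_D p diff_dir_normal[OF p] diff_normal[OF p] dir_normal_normal]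
    by (simp add: dir2_def)
  have L: "lor ?L (\<sigma> p) = 0" "lor ?L (n p) = - e" "lor ?L vinf = 0"
    "lor ?L (dir \<sigma> p 1) = 0" "lor ?L (dir \<sigma> p \<i>) = 0"
    using vinf_dir2_normal[OF p] lap_normal_dir[OF p]
    by (simp_all add: lor_add_left 1 2 dir_normal_symmetric[OF p] e_def lor_commute[of "dir2 n p _ _" vinf])
  have "?L + e *\<^sub>R (n p + H *\<^sub>R \<sigma> p) = 0"
    by (rule orthogonal_imp_zero[OF p])
       (simp_all add: lor_add_left[of ?L] L del: add.assoc, simp_all add: lor_linear normal_lift[OF p] normal_dir[OF p]
          normal_unit[OF p] lift_null[OF p] lor_commute[of "\<sigma> p" "dir \<sigma> p _"] lor_dir_lift[OF p]
          lor_commute[of "\<sigma> p" "n p"] lor_commute[of "\<sigma> p" vinf] lor_commute[of "n p" vinf]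
          vinf_lift[OF p] mean_curvature[OF p])
  then show ?thesis unfolding e_def[symmetric] by (simp add: eq_neg_iff_add_eq_0)
qed

end

context conformal_frame
begin

text \<open>By definition only the square of h = (vinf, n) is constant. Hence 2 h dh = 0, so dh = 0
  where h is non-zero; a zero of h makes the constant 0, and h vanishes on all of D.\<close>

lemma CMC_imp_constant_normal_component:
  assumes conn: "connected D" and cmc: "CMC_in D \<sigma> vinf" and D: "p \<in> D" "p' \<in> D"
  shows "lor vinf (n p) = lor vinf (n p')"
proof -
  obtain c where c: "\<And>p. p \<in> D \<Longrightarrow> (lor vinf (n p))\<^sup>2 = c" using cmc CMC_in_iff by blast
  let ?h = "\<lambda>p. lor vinf (n p)"
  have h: "?h differentiable (at p)" if "p \<in> D" for p
    by (rule differentiable_bounded_bilinear[OF bounded_bilinear_lor differentiable_const diff_normal[OF that]])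
  have "dir ?h p X = 0" if p: "p \<in> D" for p X
  proof (cases "?h p = 0")
    case True
    then have "c = 0" using c[OF p] by simp
    then have "dir ?h p X = dir (\<lambda>_. 0) p X"
      using c by (intro dir_cong_open[OF open_D p]) auto
    then show ?thesis by simp
  next
    case False
    have "dir (\<lambda>p. ?h p * ?h p) p X = dir (\<lambda>_. c) p X"
      using c by (intro dir_cong_open[OF open_D p]) (simp add: power2_eq_square)
    then show ?thesis
      using False by (simp add: dir_bounded_bilinear[OF bounded_bilinear_mult h[OF p] h[OF p]])
  qed
  then show ?thesis using D h by (intro dir_zero_constant[OF open_D conn]) auto
qed

text \<open>The case of a surface contained in the 2-sphere determined by \<open>vinf\<close>.\<close>

lemma orthogonal_lift_imp_normal:
  assumes orth: "\<And>p. p \<in> D \<Longrightarrow> lor vinf (\<sigma> p) = 0" and p: "p \<in> D"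
  shows "vinf = lor vinf (n p) *\<^sub>R n p"
proof -
  have 1: "lor vinf (dir \<sigma> p X) = 0" if "p \<in> D" for p X
    using lor_dir_swap[OF open_D that differentiable_const diff_lift[OF that] orth] by simp
  have 2: "lor vinf (dir2 \<sigma> p X Y) = 0" if "p \<in> D" for p X Y
    using lor_dir_swap[OF open_D that differentiable_const diff_dir_lift[OF that] 1]
    by (simp add: dir2_def)
  have n: "lor (n p) (n p) = 1" "lor (n p) (\<sigma> p) = 0" "lor (n p) (dir \<sigma> p 1) = 0"
    "lor (n p) (dir \<sigma> p \<i>) = 0" "lor (n p) (lap p) = 0"
    using normal_unit[OF p] normal_lift[OF p] normal_dir[OF p] normal_lap[OF p] by simp_all
  have "lor (vinf - lor vinf (n p) *\<^sub>R n p) z = 0" for z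
  proof -
    obtain c1 c2 c3 c4 c5 where "z = c1 *s \<sigma> p + c2 *s dir \<sigma> p 1 + c3 *s dir \<sigma> p \<i>
        + c4 *s lap p + c5 *s n p"
      by (rule orthogonal_frame_decomposition[of "dir \<sigma> p 1" "factor p" "dir \<sigma> p \<i>" "lap p" "\<sigma> p" "n p" z])
         (use factor_pos[OF p] in \<open>simp_all add: n lor_dir_dir[OF p] lor_dir_lift[OF p]
            lift_null[OF p] lap_relations[OF p]\<close>)
    moreover have "lor vinf (lap p) = 0" using 2[OF p] by (simp add: lap_def lor_linear)
    ultimately show ?thesis
      using orth[OF p] 1[OF p] n by (simp add: lor_linear)
  qed
  then show ?thesis using lor_nondegenerate eq_iff_diff_eq_0 by blast
qed

lemma Lambda1_rescale:
  assumes k: "smooth_on D k" and p: "p \<in> D"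
  shows "cvec (dir (\<lambda>p. k p *\<^sub>R \<sigma> p) p X) \<in> Lambda1 \<sigma> p"
  unfolding dir_rescale[OF k p] cvec_add cvec_scaleR
  by (intro Lambda1_add Lambda1_scale Lambda1_dir Lambda1_lift p)

text \<open>The alternative \<open>dich\<close> is reached by shrinking the disc. In its first case
  the lift can be scaled into the space-form; in the second the disc lies in the 2-sphere orthogonal
  to vinf.\<close>

lemma CMC_imp_conserved:
  assumes conn: "connected D" and ne: "D \<noteq> {}" and vinf: "vinf \<noteq> 0" and cmc: "CMC_in D \<sigma> vinf"
    and dich: "(\<forall>p\<in>D. lor vinf (\<sigma> p) \<noteq> 0) \<or> (\<forall>p\<in>D. lor vinf (\<sigma> p) = 0)"
  shows "\<exists>q. multiplier D \<sigma> q \<and> (\<exists>v v0. conserved_quantity D \<sigma> q v v0)"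
proof -
  obtain H where H: "\<And>p. p \<in> D \<Longrightarrow> lor vinf (n p) = H"
    using CMC_imp_constant_normal_component[OF conn cmc] ne by (metis ex_in_conv)
  have nH: "lor (n p) vinf = H" if "p \<in> D" for p using H[OF that] by (simp add: lor_commute)
  from dich show ?thesis
  proof
    assume nz: "\<forall>p\<in>D. lor vinf (\<sigma> p) \<noteq> 0"
    define k where "k p = - inverse (lor vinf (\<sigma> p))" for p
    have "smooth_on D (\<lambda>p. inverse (lor vinf (\<sigma> p)))"
      using nz by (intro smooth_on_inverse open_D smooth_on_bounded_bilinear[OF open_D bounded_bilinear_lor]
          smooth_on_const smooth_lift) auto
    from smooth_on_bounded_linear[OF open_D bounded_linear_minus[OF bounded_linear_ident] this]
    have k: "smooth_on D k" by (simp add: k_def[abs_def])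
    interpret R: conformal_frame D "\<lambda>p. k p *\<^sub>R \<sigma> p" n
      using nz by (intro conformal_frame_rescale k) (simp add: k_def)
    have vk: "lor vinf (k p *\<^sub>R \<sigma> p) = - 1" if "p \<in> D" for p
      using nz that by (simp add: k_def lor_linear)
    interpret R: cmc_frame D "\<lambda>p. k p *\<^sub>R \<sigma> p" n vinf H
      using vk H by unfold_locales auto
    have L: "cvec (dir n p X) \<in> Lambda1 \<sigma> p" if p: "p \<in> D" for p X
      unfolding dir_combine[OF diff_normal[OF p], of X] R.dir_normal_eq[OF p] cvec_add cvec_diff cvec_scaleR
      by (intro Lambda1_add Lambda1_diff Lambda1_scale Lambda1_rescale k p)
    have vd: "lor vinf (k p *\<^sub>R \<sigma> p) *\<^sub>R dir n p X = - dir n p X" if "p \<in> D" for p X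
      unfolding vk[OF that] by simp
    show ?thesis
      using multiplier_and_conserved_quantity[OF ne vinf R.smooth_lift refl nH vd L R.lap_normal R.rwedge_dir_normal]
      by blast
  next
    assume "\<forall>p\<in>D. lor vinf (\<sigma> p) = 0"
    then have vH: "vinf = H *\<^sub>R n p" if "p \<in> D" for p
      using orthogonal_lift_imp_normal[of vinf p] H[OF that] that by simp
    \<comment> \<open>As vinf = H n is non-zero, H is invertible and n = vinf / H is
      constant.\<close>
    have H0: "H \<noteq> 0" using vH vinf ne by auto
    have dn: "dir n p X = 0" if p: "p \<in> D" for p X
    proof -
      have "dir n p X = dir (\<lambda>_. inverse H *\<^sub>R vinf) p X"
        by (rule dir_cong_open[OF open_D p]) (use vH H0 in simp)
      then show ?thesis by simp
    qed
    have dn2: "dir2 n p X Y = 0" if p: "p \<in> D" for p X Y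
    proof -
      have "dir2 n p X Y = dir (\<lambda>_. 0) p Y"
        unfolding dir2_def by (rule dir_cong_open[OF open_D p dn])
      then show ?thesis by simp
    qed
    have L: "cvec (dir n p X) \<in> Lambda1 \<sigma> p" if "p \<in> D" for p X
      using Lambda1_scale[OF Lambda1_lift[OF that], of 0] by (simp add: dn[OF that])
    have "multiplier D \<sigma> (\<lambda>p X. rwedge ((H/2) *\<^sub>R \<sigma> p) (dir n p X))"
      "conserved_quantity D \<sigma> (\<lambda>p X. rwedge ((H/2) *\<^sub>R \<sigma> p) (dir n p X))
        (\<lambda>p. complex_of_real (H/2) *s cvec (n p)) (\<lambda>p. cvec vinf - complex_of_real H *s cvec (n p))"
      by (rule multiplier_and_conserved_quantity[where k = "\<lambda>_. 1", OF ne vinf smooth_lift _ nH _ L];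
          simp add: dn dn2 rwedge.zero_right)+
    then show ?thesis by blast
  qed
qed

end

section \<open>Restriction to smaller charts\<close>

text \<open>\<open>inv_into\<close> depends on the domain, so the inverse of the restricted chart
  must be compared with the original one. Images of overlaps are shown open because
  \<open>dir_cong_open\<close> compares derivatives of transition maps there.\<close>

lemma is_chart_restrict:
  assumes c: "is_chart (W, z)" and B: "open B" "B \<subseteq> z ` W"
  defines "W' \<equiv> W \<inter> z -` B"
  shows "is_chart (W', z)" and "z ` W' = B"
    and "\<And>x. x \<in> B \<Longrightarrow> inv_into W' z x = inv_into W z x"
    and "\<And>V. open V \<Longrightarrow> open (z ` (W' \<inter> V))"
proof -
  have W: "open W" "open (z ` W)" and hom: "homeomorphism W (z ` W) z (inv_into W z)"
    using c by (auto simp: is_chart_def)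
  have inj: "inj_on z W" using hom unfolding homeomorphism_def by (metis inj_onI)
  have W'W: "W' \<subseteq> W" by (auto simp: W'_def)
  show zW': "z ` W' = B" using B(2) by (auto simp: W'_def)
  show inv: "inv_into W' z x = inv_into W z x" if "x \<in> B" for x
  proof -
    obtain y where "y \<in> W'" "x = z y" using \<open>x \<in> B\<close> zW' by blast
    then show ?thesis
      using inj W'W inj_on_subset[OF inj W'W] by (simp add: inv_into_f_f subset_iff)
  qed
  have oW': "open W'"
    unfolding W'_def using hom W B by (auto simp: homeomorphism_def intro: continuous_open_preimage)
  have "homeomorphism W' B z (inv_into W z)"
    by (rule homeomorphism_of_subsets[OF hom W'W B(2) zW'])
  then have "homeomorphism W' B z (inv_into W' z)"
    by (rule homeomorphism_cong) (auto simp: inv)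
  then show "is_chart (W', z)" by (simp add: is_chart_def oW' zW' B)
  fix V :: "'a set" assume "open V"
  then have "open (W' \<inter> V)" using oW' by blast
  then have "openin (top_of_set W) (W' \<inter> V)" using W'W by (auto simp: openin_open_eq[OF W(1)])
  then have "openin (top_of_set (z ` W)) (z ` (W' \<inter> V))"
    using homeomorphism_imp_open_map[OF hom] by blast
  then show "open (z ` (W' \<inter> V))" using W(2) openin_open_eq by blast
qed

lemma holomorphic_lift_restrict:
  assumes h: "holomorphic_lift A \<Lambda> W z \<sigma>" and A: "oriented_atlas A" and B: "open B" "B \<subseteq> z ` W"
  shows "holomorphic_lift A \<Lambda> (W \<inter> z -` B) z \<sigma>"
proof -
  let ?W = "W \<inter> z -` B"
  have l: "lift A \<Lambda> W z \<sigma>" using h by (simp add: holomorphic_lift_def)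
  then have oc: "oriented_chart A (W, z)" by (simp add: lift_def)
  then have c: "is_chart (W, z)" by (simp add: oriented_chart_def)
  note r = is_chart_restrict[OF c B]
  have "compatible (?W, z) d \<and> compatible d (?W, z)" if d: "d \<in> A" for d
  proof -
    obtain V w where Vw: "d = (V, w)" by (cases d)
    have 1: "compatible (W, z) (V, w)" and 2: "compatible (V, w) (W, z)"
      using oc d by (auto simp: oriented_chart_def Vw)
    have "is_chart (V, w)" using A d Vw by (auto simp: oriented_atlas_def)
    then have "open V" by (simp add: is_chart_def)
    then have o: "open (z ` (?W \<inter> V))" by (rule r(4))
    have eq: "(w \<circ> inv_into W z) x = (w \<circ> inv_into ?W z) x" if "x \<in> z ` (?W \<inter> V)" for x
      using r(3)[of x] that by auto
    have sub: "z ` (?W \<inter> V) \<subseteq> z ` (W \<inter> V)" "w ` (V \<inter> ?W) \<subseteq> w ` (V \<inter> W)" by auto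
    have f: "smooth_on (z ` (W \<inter> V)) (w \<circ> inv_into W z)"
      and pos: "\<forall>p\<in>z ` (W \<inter> V). 0 < Im (cnj (dir (w \<circ> inv_into W z) p 1) * dir (w \<circ> inv_into W z) p \<i>)"
      using 1 unfolding compatible_def by blast+
    have g: "smooth_on (z ` (?W \<inter> V)) (w \<circ> inv_into ?W z)"
      by (rule smooth_on_cong[OF o eq smooth_on_subset[OF f sub(1)]])
    have dg: "dir (w \<circ> inv_into ?W z) p X = dir (w \<circ> inv_into W z) p X"
      if "p \<in> z ` (?W \<inter> V)" for p X
      by (rule dir_cong_open[OF o that eq, symmetric])
    have "compatible (?W, z) (V, w)"
      unfolding compatible_def prod.case
    proof (intro conjI ballI)
      show "0 < Im (cnj (dir (w \<circ> inv_into ?W z) p 1) * dir (w \<circ> inv_into ?W z) p \<i>)"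
        if "p \<in> z ` (?W \<inter> V)" for p
        unfolding dg[OF that] using pos sub(1) that by blast
    qed (rule g)
    moreover have "compatible (V, w) (?W, z)"
      using 2 sub(2) smooth_on_subset[OF _ sub(2)] unfolding compatible_def prod.case by blast
    ultimately show ?thesis by (simp add: Vw)
  qed
  then have "oriented_chart A (?W, z)" using r(1) by (simp add: oriented_chart_def)
  then have "lift A \<Lambda> ?W z \<sigma>"
    using l B smooth_on_subset[OF _ B(2)] unfolding lift_def r(2) by auto
  then show ?thesis
    using h B(2) unfolding holomorphic_lift_def r(2) by auto
qed

lemma holomorphic_lift_imp_conformal_lift:
  assumes s: "surface A \<Lambda>" and h: "holomorphic_lift A \<Lambda> W z \<sigma>"
  shows "conformal_lift (z ` W) \<sigma>"
proof
  have l: "lift A \<Lambda> W z \<sigma>" using h by (simp add: holomorphic_lift_def)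
  then show "open (z ` W)" by (auto simp: lift_def oriented_chart_def is_chart_def)
  show "smooth_on (z ` W) \<sigma>" using l by (simp add: lift_def)
  fix p assume "p \<in> z ` W"
  then obtain x where x: "x \<in> W" "p = z x" by blast
  show "\<sigma> p \<noteq> 0" using l x by (simp add: lift_def)
  have "\<sigma> p \<in> \<Lambda> x" using l x by (auto simp: lift_def intro: span_base)
  then show "lor (\<sigma> p) (\<sigma> p) = 0" using s by (simp add: surface_def)
  show "\<exists>u>0. \<forall>X Y. lor (dir \<sigma> p X) (dir \<sigma> p Y) = u * (X \<bullet> Y)"
    using h \<open>p \<in> z ` W\<close> unfolding holomorphic_lift_def by blast
qed

lemma holds_on_restrictionI:
  assumes A: "oriented_atlas A" and h: "holomorphic_lift A \<Lambda> W z \<sigma>" "W \<subseteq> U"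
    and B: "open B" "B \<subseteq> z ` W" "B \<noteq> {}" and P: "P B \<sigma>"
  shows "holds_on_restriction A \<Lambda> U P"
proof -
  have "is_chart (W, z)" using h by (auto simp: holomorphic_lift_def lift_def oriented_chart_def)
  from is_chart_restrict(2)[OF this B(1,2)] have "z ` (W \<inter> z -` B) = B" .
  then show ?thesis
    unfolding holds_on_restriction_def
    using holomorphic_lift_restrict[OF h(1) A B(1,2)] h(2) B(3) P
    by (intro exI[of _ "W \<inter> z -` B"] exI[of _ z] exI[of _ \<sigma>]) auto
qed

lemma CMC_in_subset: "CMC_in D \<sigma> vinf \<Longrightarrow> E \<subseteq> D \<Longrightarrow> CMC_in E \<sigma> vinf"
  unfolding CMC_in_def constant_on_def by blast

section \<open>The equivalence on an oriented surface\<close>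

theorem theorem8p22:
  fixes A :: "('m::{t2_space, second_countable_topology}) chart set"
    and \<Lambda> :: "'m \<Rightarrow> (real ^ 5) set"
    and U :: "'m set"
  assumes "oriented_atlas A"
    and "surface A \<Lambda>"
    and "open U" and "U \<noteq> {}"
  shows "(\<exists>vinf. vinf \<noteq> 0 \<and> holds_on_restriction A \<Lambda> U (\<lambda>D \<sigma>. CMC_in D \<sigma> vinf))
     \<longleftrightarrow> holds_on_restriction A \<Lambda> U (\<lambda>D \<sigma>. constrained_Willmore D \<sigma> \<and>
            (\<exists>q. multiplier D \<sigma> q \<and> (\<exists>v v0. conserved_quantity D \<sigma> q v v0)))"
proof (intro iffI)
  assume "\<exists>vinf. vinf \<noteq> 0 \<and> holds_on_restriction A \<Lambda> U (\<lambda>D \<sigma>. CMC_in D \<sigma> vinf)"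
  then obtain vinf W z \<sigma> where vinf: "vinf \<noteq> 0" and h: "holomorphic_lift A \<Lambda> W z \<sigma>"
    and W: "W \<noteq> {}" "W \<subseteq> U" and cmc: "CMC_in (z ` W) \<sigma> vinf"
    unfolding holds_on_restriction_def by blast
  interpret conformal_lift "z ` W" \<sigma>
    by (rule holomorphic_lift_imp_conformal_lift[OF assms(2) h])
  obtain p0 where "p0 \<in> z ` W" using W by blast
  then obtain r n where r: "0 < r" "ball p0 r \<subseteq> z ` W" and fr: "conformal_frame (ball p0 r) \<sigma> n"
    by (rule exists_frame)
  \<comment> \<open>\<open>surface\<close> excludes 2-spheres for the surface as a whole, so
    \<open>lor vinf (\<sigma> p)\<close> may still vanish on all of a small disc; otherwise it is
    non-zero on some smaller disc.\<close>
  obtain p1 s where s: "0 < s" "ball p1 s \<subseteq> ball p0 r"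
    and dich: "(\<forall>p\<in>ball p1 s. lor vinf (\<sigma> p) \<noteq> 0) \<or> (\<forall>p\<in>ball p1 s. lor vinf (\<sigma> p) = 0)"
  proof (cases "\<forall>p\<in>ball p0 r. lor vinf (\<sigma> p) = 0")
    case True
    then show thesis using that r by blast
  next
    case False
    then obtain p1 where p1: "p1 \<in> ball p0 r" "lor vinf (\<sigma> p1) \<noteq> 0" by blast
    have "continuous_on (ball p0 r) (\<lambda>p. lor vinf (\<sigma> p))"
      by (intro smooth_on_continuous_on smooth_on_bounded_bilinear[OF open_ball bounded_bilinear_lor]
          smooth_on_const smooth_on_subset[OF smooth_lift r(2)])
    then have "open (ball p0 r \<inter> (\<lambda>p. lor vinf (\<sigma> p)) -` (- {0}))"
      by (rule continuous_open_preimage) auto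
    moreover have "p1 \<in> ball p0 r \<inter> (\<lambda>p. lor vinf (\<sigma> p)) -` (- {0})" using p1 by simp
    ultimately obtain s where "0 < s" "ball p1 s \<subseteq> ball p0 r \<inter> (\<lambda>p. lor vinf (\<sigma> p)) -` (- {0})"
      by (rule openE)
    then show thesis using that[of s p1] by blast
  qed
  interpret F: conformal_frame "ball p1 s" \<sigma> n
    by (rule conformal_frame.conformal_frame_subset[OF fr open_ball s(2)])
  have sub: "ball p1 s \<subseteq> z ` W" using s r by blast
  have "\<exists>q. multiplier (ball p1 s) \<sigma> q \<and> (\<exists>v v0. conserved_quantity (ball p1 s) \<sigma> q v v0)"
    using s by (intro F.CMC_imp_conserved[OF connected_ball _ vinf CMC_in_subset[OF cmc sub] dich]) auto
  then show "holds_on_restriction A \<Lambda> U (\<lambda>D \<sigma>. constrained_Willmore D \<sigma> \<and>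
      (\<exists>q. multiplier D \<sigma> q \<and> (\<exists>v v0. conserved_quantity D \<sigma> q v v0)))"
    using s by (intro holds_on_restrictionI[OF assms(1) h W(2) open_ball sub])
      (auto simp: constrained_Willmore_def)
next
  assume "holds_on_restriction A \<Lambda> U (\<lambda>D \<sigma>. constrained_Willmore D \<sigma> \<and>
      (\<exists>q. multiplier D \<sigma> q \<and> (\<exists>v v0. conserved_quantity D \<sigma> q v v0)))"
  then obtain W z \<sigma> q v v0 where h: "holomorphic_lift A \<Lambda> W z \<sigma>" "W \<subseteq> U"
    and q: "multiplier (z ` W) \<sigma> q" and cq: "conserved_quantity (z ` W) \<sigma> q v v0"
    unfolding holds_on_restriction_def by blast
  interpret conformal_lift "z ` W" \<sigma>
    by (rule holomorphic_lift_imp_conformal_lift[OF assms(2) h(1)])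
  \<comment> \<open>The disc is centred where p(1) is non-zero, so that the constant vector vinf =
    p(1) is non-zero.\<close>
  obtain p0 where p0: "p0 \<in> z ` W" "laurent v v0 1 p0 \<noteq> 0"
    using cq unfolding conserved_quantity_def by blast
  obtain r n where r: "0 < r" "ball p0 r \<subseteq> z ` W" and fr: "conformal_frame (ball p0 r) \<sigma> n"
    using p0(1) by (rule exists_frame)
  have skew: "lor (q p X *v w) w = 0" if "p \<in> z ` W" for p X w
  proof -
    obtain \<xi> where "q p X = wedge (cvec (\<sigma> p)) \<xi>"
      using q \<open>p \<in> z ` W\<close> unfolding multiplier_def real_form_def by blast
    then show ?thesis by (simp add: wedge_skew_self)
  qed
  have sub: "p \<in> z ` W" if "p \<in> ball p0 r" for p using that r by blast
  have cq': "smooth_on (z ` W) v" "smooth_on (z ` W) v0"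
    "\<And>p. p \<in> z ` W \<Longrightarrow> v0 p \<in> csc \<sigma> p" "\<And>p. p \<in> z ` W \<Longrightarrow> cnjv (v0 p) = v0 p"
    "\<And>p y. p \<in> z ` W \<Longrightarrow> y \<in> csc \<sigma> p \<Longrightarrow> lor (v p) y = 0"
    "\<And>\<zeta> p X. \<zeta> \<noteq> 0 \<Longrightarrow> p \<in> z ` W \<Longrightarrow> conn \<sigma> q \<zeta> X (laurent v v0 \<zeta>) p = 0"
    using cq unfolding conserved_quantity_def by blast+
  obtain vinf where "vinf \<noteq> 0" "CMC_in (ball p0 r) \<sigma> vinf"
    using conformal_frame.conserved_imp_CMC[OF fr connected_ball _ p0(2)
        smooth_on_subset[OF cq'(1) r(2)] smooth_on_subset[OF cq'(2) r(2)]
        cq'(3)[OF sub] cq'(4)[OF sub] cq'(5)[OF sub] cq'(6)[OF _ sub] skew[OF sub]] r(1)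
    by auto
  then show "\<exists>vinf. vinf \<noteq> 0 \<and> holds_on_restriction A \<Lambda> U (\<lambda>D \<sigma>. CMC_in D \<sigma> vinf)"
    using r by (intro exI[of _ vinf] conjI holds_on_restrictionI[OF assms(1) h open_ball r(2)]) auto
qed

end
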